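(* Suppose that \[C=\sup_{(x',x,y)\in\mathsf{X}\times\mathsf{X}\times\mathsf{Y}}\frac{\pi_{X|Y}(x'|y)}{q(x'|x,y)}<\infty .\] 1. If $\rho(P_{\mathrm{DG}})<1$, then $\rho(P_{\mathrm{DC}})<1$. 2. If $\rho(P_{\mathrm{RG}})<1$, then $\rho(P_{\mathrm{RC}})<1$. Here the selection probabilities in $(0,1)$ of the random-scan kernels $P_{\mathrm{RG}}$ and $P_{\mathrm{RC}}$ are arbitrary.
   Context: Setting. $(\mathsf{X}\times\mathsf{Y},\mathcal{F}_X\times\mathcal{F}_Y)$ is a product measurable space with a joint probability distribution $\Pi(dx,dy)$; $\Pi_X,\Pi_Y$ are its marginals and $\Pi_{X|Y}(dx|y)$, $\Pi_{Y|X}(dy|x)$ its full conditional distributions (regular conditional probabilities), which admit densities $\pi_{X|Y}(\cdot|y)$ and $\pi_{Y|X}(\cdot|x)$ with respect to $\sigma$-finite reference measures on $\mathsf{X}$ and $\mathsf{Y}$, written $dx$ and $dy$. Standing assumption: there exist disjoint $A_1,A_2\in\mathcal{F}_X$ with $\Pi_X(A_1),\Pi_X(A_2)>0$ and disjoint $B_1,B_2\in\mathcal{F}_Y$ with $\Pi_Y(B_1),\Pi_Y(B_2)>0$. For $(x,y)\in\mathsf{X}\times\mathsf{Y}$, $q(\cdot|x,y)$ is a proposal probability density on $\mathsf{X}$ (jointly measurable). In the supremum defining $C$, a ratio with zero denominator is $0$ if the numerator is zero and $+\infty$ otherwise. The Metropolis-Hastings kernel is \[P_{\mathrm{MH}}(dx'|x,y)=q(x'|x,y)a(x';x,y)\,dx'+\Big(1-\int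 q(z|x,y)a(z;x,y)\,dz\Big)\delta_x(dx'),\] \[a(z;x,y)=\min\Big\{1,\frac{\pi_{X|Y}(z|y)q(x|z,y)}{\pi_{X|Y}(x|y)q(z|x,y)}\Big\}\quad(\text{equal to }1\text{ if the denominator is }0).\] For each $y$ it is reversible with respect to $\Pi_{X|Y}(\cdot|y)$. Kernels on $\mathsf{X}\times\mathsf{Y}$, all with invariant distribution $\Pi$ ($r\in(0,1)$ is a selection probability; $\delta$ denotes point masses): \[P_{\mathrm{DG}}((x,y),(dx',dy'))=\Pi_{X|Y}(dx'|y')\Pi_{Y|X}(dy'|x),\] \[P_{\mathrm{RG}}((x,y),(dx',dy'))=r\,\Pi_{X|Y}(dx'|y)\delta_y(dy')+(1-r)\Pi_{Y|X}(dy'|x)\delta_x(dx'),\] \[P_{\mathrm{DC}}((x,y),(dx',dy'))=P_{\mathrm{MH}}(dx'|x,y')\Pi_{Y|X}(dy'|x),\] \[P_{\mathrm{RC}}((x,y),(dx',dy'))=r\,P_{\mathrm{MH}}(dx'|x,y)\delta_y(dy')+(1-r)\Pi_{Y|X}(dy'|x)\delta_x(dx').\] $L^2$ convergence rate. Let $P$ be a Markov transition kernel with invariant probability measure $\omega$. $L^2(\omega)$ is the real Hilbert space of square-integrable real functions, and $L_0^2(\omega)=\{f\in L^2(\omega):\int f\,d\omega=0\}$. For probability measures $\mu,\nu$, $\|\mu-\nu\|_\omega=\sup\{|\int f\,d\mu-\int f\,d\nu|: f\in L_0^2(\omega),\|f\|_\omega=1\}$. $L_*^2(\omega)$ is the set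 of probability measures $\mu$ with $d\mu/d\omega\in L^2(\omega)$. $(\mu P^n)(A)=\int \mu(dz)P^n(z,A)$, where $P^n$ is the $n$-step kernel. The $L^2$ convergence rate $\rho(P)$ is the infimum of $\rho\in[0,1]$ such that for each $\mu\in L_*^2(\omega)$ there is $C_\mu<\infty$ with $\|\mu P^n-\omega\|_\omega<C_\mu\rho^n$ for every positive integer $n$. *)

theory Defs
  imports "HOL-Probability.Probability"
begin

definition L2 :: "'a measure \<Rightarrow> ('a \<Rightarrow> real) set" where
  "L2 \<omega> = {f \<in> borel_measurable \<omega>. integrable \<omega> (\<lambda>z. (f z)\<^sup>2)}"

definition L2_norm :: "'a measure \<Rightarrow> ('a \<Rightarrow> real) \<Rightarrow> real" where
  "L2_norm \<omega> f = sqrt (\<integral>z. (f z)\<^sup>2 \<partial>\<omega>)"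

definition L2_0 :: "'a measure \<Rightarrow> ('a \<Rightarrow> real) set" where
  "L2_0 \<omega> = {f \<in> L2 \<omega>. (\<integral>z. f z \<partial>\<omega>) = 0}"

text \<open>
  Bochner integrals of non-integrable functions are 0 by convention. This does not interfere below,
  where \<open>\<mu>\<close> and \<open>\<nu>\<close> have square-integrable densities with respect to \<open>\<omega>\<close>.
\<close>

definition L2_dist :: "'a measure \<Rightarrow> 'a measure \<Rightarrow> 'a measure \<Rightarrow> ennreal" where
  "L2_dist \<omega> \<mu> \<nu> =
     (SUP f \<in> {f \<in> L2_0 \<omega>. L2_norm \<omega> f = 1}. ennreal \<bar>(\<integral>z. f z \<partial>\<mu>) - (\<integral>z. f z \<partial>\<nu>)\<bar>)"

definition L2_star :: "'a measure \<Rightarrow> 'a measure set" where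
  "L2_star \<omega> = {\<mu>. prob_space \<mu> \<and> sets \<mu> = sets \<omega> \<and> absolutely_continuous \<omega> \<mu> \<and>
                   (\<lambda>z. enn2real (RN_deriv \<omega> \<mu> z)) \<in> L2 \<omega>}"

primrec kernel_pow :: "'a measure \<Rightarrow> ('a \<Rightarrow> 'a measure) \<Rightarrow> nat \<Rightarrow> 'a \<Rightarrow> 'a measure" where
  "kernel_pow M P 0 = return M"
| "kernel_pow M P (Suc n) = (\<lambda>z. P z \<bind> kernel_pow M P n)"

definition L2_rate :: "'a measure \<Rightarrow> ('a \<Rightarrow> 'a measure) \<Rightarrow> real" where
  "L2_rate \<omega> P = Inf {\<rho> \<in> {0..1}. \<forall>\<mu> \<in> L2_star \<omega>. \<exists>C::real. \<forall>n::nat. 0 < n \<longrightarrow>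
     L2_dist \<omega> (\<mu> \<bind> kernel_pow \<omega> P n) \<omega> < ennreal (C * \<rho> ^ n)}"

text \<open>
  In all that follows, \<open>MX\<close> and \<open>MY\<close> are the reference measures; they also carry the sigma-algebras of the
  two component spaces.
\<close>

definition marginal_fst :: "'a measure \<Rightarrow> ('a \<times> 'b) measure \<Rightarrow> 'a measure" where
  "marginal_fst MX PI = distr PI MX fst"

definition marginal_snd :: "'b measure \<Rightarrow> ('a \<times> 'b) measure \<Rightarrow> 'b measure" where
  "marginal_snd MY PI = distr PI MY snd"

definition cond_fst_given_snd ::
  "'a measure \<Rightarrow> 'b measure \<Rightarrow> ('a \<times> 'b) measure \<Rightarrow> ('b \<Rightarrow> 'a measure) \<Rightarrow> bool" where
  "cond_fst_given_snd MX MY PI K \<longleftrightarrow>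
     K \<in> MY \<rightarrow>\<^sub>M prob_algebra MX \<and>
     (\<forall>A \<in> sets MX. \<forall>B \<in> sets MY.
        emeasure PI (A \<times> B) = (\<integral>\<^sup>+ y \<in> B. emeasure (K y) A \<partial>marginal_snd MY PI))"

definition cond_snd_given_fst ::
  "'a measure \<Rightarrow> 'b measure \<Rightarrow> ('a \<times> 'b) measure \<Rightarrow> ('a \<Rightarrow> 'b measure) \<Rightarrow> bool" where
  "cond_snd_given_fst MX MY PI K \<longleftrightarrow>
     K \<in> MX \<rightarrow>\<^sub>M prob_algebra MY \<and>
     (\<forall>A \<in> sets MX. \<forall>B \<in> sets MY.
        emeasure PI (A \<times> B) = (\<integral>\<^sup>+ x \<in> A. emeasure (K x) B \<partial>marginal_fst MX PI))"

definition add_measure :: "'a measure \<Rightarrow> 'a measure \<Rightarrow> 'a measure" where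
  "add_measure M N = measure_of (space M) (sets M) (\<lambda>A. emeasure M A + emeasure N A)"

lemma sets_add_measure [simp, measurable_cong]: "sets (add_measure M N) = sets M"
  by (simp add: add_measure_def)

lemma space_add_measure [simp]: "space (add_measure M N) = space M"
  by (simp add: add_measure_def)

lemma emeasure_add_measure:
  assumes "sets N = sets M" and "A \<in> sets M"
  shows "emeasure (add_measure M N) A = emeasure M A + emeasure N A"
proof (rule emeasure_measure_of[OF add_measure_def])
  show "countably_additive (sets (add_measure M N)) (\<lambda>A. emeasure M A + emeasure N A)"
    unfolding countably_additive_def
    by (auto simp: assms(1) suminf_add[symmetric] suminf_emeasure)
qed (use assms in \<open>auto simp: positive_def sets.space_closed\<close>)

text \<open>
  Arguments are ordered as in the mathematical notation: \<open>pXY x y\<close> is the density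
  at \<open>x\<close> of the first component given \<open>y\<close>, and \<open>q x' x y\<close> is the proposal density at \<open>x'\<close>
  when the current state is \<open>(x, y)\<close>.
\<close>

definition MH_accept ::
  "('a \<Rightarrow> 'b \<Rightarrow> real) \<Rightarrow> ('a \<Rightarrow> 'a \<Rightarrow> 'b \<Rightarrow> real) \<Rightarrow> 'a \<Rightarrow> 'a \<Rightarrow> 'b \<Rightarrow> real" where
  "MH_accept pXY q z x y =
     (if pXY x y * q z x y = 0 then 1
      else min 1 ((pXY z y * q x z y) / (pXY x y * q z x y)))"

definition P_MH ::
  "'a measure \<Rightarrow> ('a \<Rightarrow> 'b \<Rightarrow> real) \<Rightarrow> ('a \<Rightarrow> 'a \<Rightarrow> 'b \<Rightarrow> real) \<Rightarrow> 'a \<Rightarrow> 'b \<Rightarrow> 'a measure" where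
  "P_MH MX pXY q x y =
     add_measure
       (density MX (\<lambda>x'. ennreal (q x' x y * MH_accept pXY q x' x y)))
       (scale_measure (ennreal (1 - (\<integral>z. q z x y * MH_accept pXY q z x y \<partial>MX))) (return MX x))"

definition P_DG ::
  "'b measure \<Rightarrow> ('b \<Rightarrow> 'a measure) \<Rightarrow> ('a \<Rightarrow> 'b measure) \<Rightarrow> 'a \<times> 'b \<Rightarrow> ('a \<times> 'b) measure" where
  "P_DG MY KXY KYX = (\<lambda>(x, y). KYX x \<bind> (\<lambda>y'. KXY y' \<Otimes>\<^sub>M return MY y'))"

definition P_RG ::
  "'a measure \<Rightarrow> 'b measure \<Rightarrow> ('b \<Rightarrow> 'a measure) \<Rightarrow> ('a \<Rightarrow> 'b measure) \<Rightarrow> real \<Rightarrow>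
   'a \<times> 'b \<Rightarrow> ('a \<times> 'b) measure" where
  "P_RG MX MY KXY KYX r = (\<lambda>(x, y).
     add_measure (scale_measure (ennreal r) (KXY y \<Otimes>\<^sub>M return MY y))
                 (scale_measure (ennreal (1 - r)) (return MX x \<Otimes>\<^sub>M KYX x)))"

definition P_DC ::
  "'a measure \<Rightarrow> 'b measure \<Rightarrow> ('a \<Rightarrow> 'b \<Rightarrow> real) \<Rightarrow> ('a \<Rightarrow> 'a \<Rightarrow> 'b \<Rightarrow> real) \<Rightarrow>
   ('a \<Rightarrow> 'b measure) \<Rightarrow> 'a \<times> 'b \<Rightarrow> ('a \<times> 'b) measure" where
  "P_DC MX MY pXY q KYX =
     (\<lambda>(x, y). KYX x \<bind> (\<lambda>y'. P_MH MX pXY q x y' \<Otimes>\<^sub>M return MY y'))"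

definition P_RC ::
  "'a measure \<Rightarrow> 'b measure \<Rightarrow> ('a \<Rightarrow> 'b \<Rightarrow> real) \<Rightarrow> ('a \<Rightarrow> 'a \<Rightarrow> 'b \<Rightarrow> real) \<Rightarrow>
   ('a \<Rightarrow> 'b measure) \<Rightarrow> real \<Rightarrow> 'a \<times> 'b \<Rightarrow> ('a \<times> 'b) measure" where
  "P_RC MX MY pXY q KYX r = (\<lambda>(x, y).
     add_measure (scale_measure (ennreal r) (P_MH MX pXY q x y \<Otimes>\<^sub>M return MY y))
                 (scale_measure (ennreal (1 - r)) (return MX x \<Otimes>\<^sub>M KYX x)))"

text \<open>
  Division on \<^typ>\<open>ennreal\<close> satisfies \<open>0 / 0 = 0\<close> and \<open>a / 0 = \<infinity>\<close> for \<open>a > 0\<close>, which is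
  the convention required for ratios with zero denominator.
\<close>

definition ratio_sup ::
  "'a measure \<Rightarrow> 'b measure \<Rightarrow> ('a \<Rightarrow> 'b \<Rightarrow> real) \<Rightarrow> ('a \<Rightarrow> 'a \<Rightarrow> 'b \<Rightarrow> real) \<Rightarrow> ennreal" where
  "ratio_sup MX MY pXY q =
     (SUP (x', x, y) \<in> space MX \<times> space MX \<times> space MY. ennreal (pXY x' y) / ennreal (q x' x y))"

end

theory Submission
  imports Defs
begin

text \<open>
  Every Markov kernel \<open>P\<close> with invariant distribution \<open>PI\<close> acts on square-integrable functions by
  \<open>(P f) z = \<integral>w. f w \<partial>P z\<close>, and this action is a contraction by Jensen's inequality. The argument
  passes through the inequality \<open>\<parallel>P f\<parallel>\<^sup>2 \<le> \<kappa> \<parallel>f\<parallel>\<^sup>2\<close>, with some \<open>\<kappa> < 1\<close>, for centred \<open>f\<close>.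

  If \<open>P\<close> contracts in this sense, then \<open>P\<close> has \<open>L\<^sup>2\<close> rate below one, by the Cauchy-Schwarz inequality
  (\<open>rate_less_one_if_contraction\<close>). In general the converse fails, but it holds for the two Gibbs
  samplers. A rate below one makes \<open>\<integral> h \<sqdot> P\<^sup>n f\<close> decay geometrically, with a constant that depends on \<open>h\<close>
  (\<open>weak_decay\<close>). For a self-adjoint operator the sequence \<open>\<parallel>P\<^sup>n f\<parallel>\<^sup>2\<close> is log-convex, so its first ratio
  is the smallest one, and weak decay at rate \<open>\<rho>\<close> already forces \<open>\<parallel>P f\<parallel> \<le> \<rho> \<parallel>f\<parallel>\<close>
  (\<open>hankel_first_step\<close>). The
  random-scan Gibbs operator is a convex combination of two orthogonal projections, hence
  self-adjoint. The deterministic-scan operator is a product \<open>E\<^sub>X E\<^sub>Y\<close> of two orthogonal projections; here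
  the log-convexity argument is applied to the self-adjoint operator \<open>E\<^sub>Y E\<^sub>X E\<^sub>Y\<close>
  (\<open>contraction_alternating\<close>).

  The Metropolis-Hastings kernel enters through a minorization: if the ratio of target density to
  proposal density is at most \<open>C\<close>, then the accepted part of the kernel alone dominates \<open>1/C\<close> times the
  exact conditional distribution (\<open>move_minorized\<close>). Hence each sampler with a Metropolis-Hastings step
  dominates a multiple \<open>c\<close> of the corresponding Gibbs sampler. Domination of kernels carries over to
  their conditional variances, and for kernels with a common invariant distribution the integrated
  conditional variance is \<open>\<parallel>f\<parallel>\<^sup>2 - \<parallel>P f\<parallel>\<^sup>2\<close>. So a bound \<open>\<kappa>\<close> for the Gibbs sampler yields the bound
  \<open>1 - c (1 - \<kappa>)\<close> for the other one (\<open>rate_less_one_if_minorized\<close>).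
\<close>

section \<open>Square-integrable functions\<close>

lemma L2_measurable [measurable_dest]: "f \<in> L2 \<omega> \<Longrightarrow> f \<in> borel_measurable \<omega>"
  by (simp add: L2_def)

lemma L2_square_integrable: "f \<in> L2 \<omega> \<Longrightarrow> integrable \<omega> (\<lambda>z. (f z)\<^sup>2)"
  by (simp add: L2_def)

lemma L2_mult_integrable:
  assumes "f \<in> L2 \<omega>" "g \<in> L2 \<omega>"
  shows "integrable \<omega> (\<lambda>z. f z * g z)"
proof (rule Bochner_Integration.integrable_bound)
  show "integrable \<omega> (\<lambda>z. (f z)\<^sup>2 + (g z)\<^sup>2)"
    using assms by (simp add: L2_def)
  show "(\<lambda>z. f z * g z) \<in> borel_measurable \<omega>"
    using assms by (intro borel_measurable_times) (auto simp: L2_def)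
  have "\<bar>a * b\<bar> \<le> a\<^sup>2 + b\<^sup>2" for a b :: real
    using sum_squares_bound[of "\<bar>a\<bar>" "\<bar>b\<bar>"] abs_ge_zero[of "a * b"]
    by (simp only: abs_mult power2_abs)
  then show "AE z in \<omega>. norm (f z * g z) \<le> norm ((f z)\<^sup>2 + (g z)\<^sup>2)"
    by simp
qed

lemma (in prob_space) L2_integrable: "f \<in> L2 M \<Longrightarrow> integrable M f"
  by (auto simp: L2_def intro: square_integrable_imp_integrable)

lemma L2_linear:
  assumes "f \<in> L2 \<omega>" "g \<in> L2 \<omega>"
  shows "(\<lambda>z. a * f z + b * g z) \<in> L2 \<omega>"
proof -
  have "integrable \<omega> (\<lambda>z. a\<^sup>2 * (f z)\<^sup>2 + 2 * a * b * (f z * g z) + b\<^sup>2 * (g z)\<^sup>2)"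
    using L2_mult_integrable[OF assms] assms by (auto simp: L2_def)
  then show ?thesis
    using assms by (auto simp: L2_def power2_sum algebra_simps)
qed

lemma L2_Cauchy_Schwarz:
  assumes f: "f \<in> L2 \<omega>" and g: "g \<in> L2 \<omega>"
  shows "(\<integral>z. f z * g z \<partial>\<omega>)\<^sup>2 \<le> (\<integral>z. (f z)\<^sup>2 \<partial>\<omega>) * (\<integral>z. (g z)\<^sup>2 \<partial>\<omega>)"
proof -
  define F I G where "F = (\<integral>z. (f z)\<^sup>2 \<partial>\<omega>)" "I = (\<integral>z. f z * g z \<partial>\<omega>)" "G = (\<integral>z. (g z)\<^sup>2 \<partial>\<omega>)"
  have *: "0 \<le> a\<^sup>2 * F - 2 * a * b * I + b\<^sup>2 * G" for a b
  proof -
    have "0 \<le> (\<integral>z. (a * f z - b * g z)\<^sup>2 \<partial>\<omega>)"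
      by simp
    also have "\<dots> = (\<integral>z. a\<^sup>2 * (f z)\<^sup>2 - 2 * a * b * (f z * g z) + b\<^sup>2 * (g z)\<^sup>2 \<partial>\<omega>)"
      by (simp add: power2_diff power_mult_distrib algebra_simps)
    also have "\<dots> = a\<^sup>2 * F - 2 * a * b * I + b\<^sup>2 * G"
      using L2_mult_integrable[OF f g] f g by (simp add: L2_def F_I_G_def)
    finally show ?thesis .
  qed
  have "I\<^sup>2 \<le> F * G"
  proof (cases "G = 0")
    case True
    have "I = 0"
    proof (rule ccontr)
      assume "I \<noteq> 0"
      then have "2 * 1 * ((F + 1) / (2 * I)) * I = F + 1"
        by simp
      then show False
        using *[of 1 "(F + 1) / (2 * I)"] True by simp
    qed
    then show ?thesis
      using True by simp
  next
    case False
    moreover have "0 \<le> G"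
      by (simp add: F_I_G_def)
    ultimately have G: "0 < G"
      by simp
    have "G * I\<^sup>2 \<le> G * (F * G)"
      using *[of G I] by (simp add: algebra_simps power2_eq_square)
    then show ?thesis
      using G by simp
  qed
  then show ?thesis
    by (simp add: F_I_G_def)
qed

lemma L2_norm_nonneg [simp]: "0 \<le> L2_norm \<omega> f"
  by (simp add: L2_norm_def)

lemma L2_norm_square: "(L2_norm \<omega> f)\<^sup>2 = (\<integral>z. (f z)\<^sup>2 \<partial>\<omega>)"
  by (simp add: L2_norm_def)

lemma L2_inner_le_norms:
  assumes "f \<in> L2 \<omega>" "g \<in> L2 \<omega>"
  shows "\<bar>\<integral>z. f z * g z \<partial>\<omega>\<bar> \<le> L2_norm \<omega> f * L2_norm \<omega> g"
  using L2_Cauchy_Schwarz[OF assms] abs_le_square_iff[of "\<integral>z. f z * g z \<partial>\<omega>" "L2_norm \<omega> f * L2_norm \<omega> g"]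
  by (simp add: L2_norm_square power_mult_distrib)

section \<open>Integration against a Markov kernel\<close>

definition kernel_op :: "('a \<Rightarrow> 'b measure) \<Rightarrow> ('b \<Rightarrow> real) \<Rightarrow> 'a \<Rightarrow> real" where
  "kernel_op K f = (\<lambda>z. \<integral>w. f w \<partial>K z)"

lemma kernel_op_measurable:
  assumes "K \<in> M \<rightarrow>\<^sub>M subprob_algebra N" "f \<in> borel_measurable N"
  shows "kernel_op K f \<in> borel_measurable M"
  unfolding kernel_op_def
  by (rule measurable_compose[OF assms(1) integral_measurable_subprob_algebra[OF assms(2)]])

text \<open>
  The positive and the negative part of \<open>f\<close> each satisfy the identity for nonnegative integrals. The
  finiteness assumption makes all four integrals finite, outside a null set of starting points, so that
  their differences may be formed.
\<close>

lemma
  fixes f :: "'b \<Rightarrow> real"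
  assumes K: "K \<in> M \<rightarrow>\<^sub>M subprob_algebra N" and f: "f \<in> borel_measurable N"
    and fin: "(\<integral>\<^sup>+z. \<integral>\<^sup>+w. ennreal \<bar>f w\<bar> \<partial>K z \<partial>M) < \<infinity>" and ne: "space M \<noteq> {}"
  shows integral_bind_kernel: "(\<integral>w. f w \<partial>(M \<bind> K)) = (\<integral>z. kernel_op K f z \<partial>M)"
    and AE_integrable_bind_kernel: "AE z in M. integrable (K z) f"
proof -
  have sets: "sets (M \<bind> K) = sets N"
    by (rule sets_bind_measurable[OF K ne])
  have fK: "z \<in> space M \<Longrightarrow> f \<in> borel_measurable (K z)" for z
    using f sets_kernel[OF K] by (simp cong: measurable_cong_sets)
  have nn: "(\<integral>\<^sup>+w. ennreal (g w) \<partial>(M \<bind> K)) = (\<integral>\<^sup>+z. \<integral>\<^sup>+w. ennreal (g w) \<partial>K z \<partial>M)"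
    if "g \<in> borel_measurable N" for g
    using that by (intro nn_integral_bind[OF _ K]) auto
  have meas: "(\<lambda>z. \<integral>\<^sup>+w. ennreal (g w) \<partial>K z) \<in> borel_measurable M" if "g \<in> borel_measurable N" for g
    using that by (intro measurable_compose[OF K] nn_integral_measurable_subprob_algebra) auto
  have int: "integrable (M \<bind> K) f"
    using fin f nn[of "\<lambda>w. \<bar>f w\<bar>"] sets
    by (simp add: integrable_iff_bounded cong: measurable_cong_sets)
  have "AE z in M. (\<integral>\<^sup>+w. ennreal \<bar>f w\<bar> \<partial>K z) \<noteq> \<infinity>"
    using fin f by (intro nn_integral_PInf_AE meas) auto
  then show AE: "AE z in M. integrable (K z) f"
    using fK by (auto simp: integrable_iff_bounded less_top elim!: eventually_mono[OF AE_conjI[OF AE_space]])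
  have pos: "AE z in M. ennreal (enn2real (\<integral>\<^sup>+w. ennreal (f w) \<partial>K z)) = (\<integral>\<^sup>+w. ennreal (f w) \<partial>K z)"
    using AE by eventually_elim (auto simp: real_integrable_def less_top)
  have neg: "AE z in M. ennreal (enn2real (\<integral>\<^sup>+w. ennreal (- f w) \<partial>K z)) = (\<integral>\<^sup>+w. ennreal (- f w) \<partial>K z)"
    using AE by eventually_elim (auto simp: real_integrable_def less_top)
  have op: "AE z in M. kernel_op K f z =
      enn2real (\<integral>\<^sup>+w. ennreal (f w) \<partial>K z) - enn2real (\<integral>\<^sup>+w. ennreal (- f w) \<partial>K z)"
    using AE by eventually_elim (auto simp: kernel_op_def real_lebesgue_integral_def)
  have int_part: "integrable M (\<lambda>z. enn2real (\<integral>\<^sup>+w. ennreal (g w) \<partial>K z))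
      \<and> (\<integral>z. enn2real (\<integral>\<^sup>+w. ennreal (g w) \<partial>K z) \<partial>M) = enn2real (\<integral>\<^sup>+w. ennreal (g w) \<partial>(M \<bind> K))"
    if g: "g \<in> borel_measurable N" and le: "\<And>w. g w \<le> \<bar>f w\<bar>"
      and ae: "AE z in M. ennreal (enn2real (\<integral>\<^sup>+w. ennreal (g w) \<partial>K z)) = (\<integral>\<^sup>+w. ennreal (g w) \<partial>K z)" for g
  proof -
    have eq: "(\<integral>\<^sup>+z. ennreal (enn2real (\<integral>\<^sup>+w. ennreal (g w) \<partial>K z)) \<partial>M) = (\<integral>\<^sup>+w. ennreal (g w) \<partial>(M \<bind> K))"
      unfolding nn[OF g] by (rule nn_integral_cong_AE[OF ae])
    have "\<dots> \<le> (\<integral>\<^sup>+w. ennreal \<bar>f w\<bar> \<partial>(M \<bind> K))"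
      by (intro nn_integral_mono ennreal_leI le)
    also have "\<dots> < \<infinity>"
      using fin nn[of "\<lambda>w. \<bar>f w\<bar>"] f by simp
    finally have "(\<integral>\<^sup>+w. ennreal (g w) \<partial>(M \<bind> K)) < \<infinity>" .
    then show ?thesis
      using eq meas[OF g] by (auto simp: integrable_iff_bounded integral_eq_nn_integral)
  qed
  have p: "f w \<le> \<bar>f w\<bar>" "- f w \<le> \<bar>f w\<bar>" for w
    by auto
  have "(\<integral>z. kernel_op K f z \<partial>M) =
      (\<integral>z. enn2real (\<integral>\<^sup>+w. ennreal (f w) \<partial>K z) - enn2real (\<integral>\<^sup>+w. ennreal (- f w) \<partial>K z) \<partial>M)"
    using op kernel_op_measurable[OF K f] meas[of f] meas[of "\<lambda>w. - f w"] f
    by (intro integral_cong_AE) auto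
  also have "\<dots> = enn2real (\<integral>\<^sup>+w. ennreal (f w) \<partial>(M \<bind> K)) - enn2real (\<integral>\<^sup>+w. ennreal (- f w) \<partial>(M \<bind> K))"
    using int_part[OF f p(1) pos] int_part[OF _ p(2) neg] f by simp
  also have "\<dots> = (\<integral>w. f w \<partial>(M \<bind> K))"
    using int by (simp add: real_lebesgue_integral_def)
  finally show "(\<integral>w. f w \<partial>(M \<bind> K)) = (\<integral>z. kernel_op K f z \<partial>M)" ..
qed

locale invariant_kernel = prob_space \<omega> for \<omega> :: "'a measure" +
  fixes P :: "'a \<Rightarrow> 'a measure"
  assumes kernel: "P \<in> \<omega> \<rightarrow>\<^sub>M prob_algebra \<omega>" and invariant: "\<omega> \<bind> P = \<omega>"
begin

lemma subkernel: "P \<in> \<omega> \<rightarrow>\<^sub>M subprob_algebra \<omega>"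
  by (rule measurable_prob_algebraD[OF kernel])

lemma prob_space_P: "z \<in> space \<omega> \<Longrightarrow> prob_space (P z)"
  using measurable_space[OF kernel] by (simp add: space_prob_algebra)

lemma sets_P: "z \<in> space \<omega> \<Longrightarrow> sets (P z) = sets \<omega>"
  using measurable_space[OF kernel] by (simp add: space_prob_algebra)

lemma space_P: "z \<in> space \<omega> \<Longrightarrow> space (P z) = space \<omega>"
  by (rule sets_eq_imp_space_eq[OF sets_P])

lemma measurable_P: "z \<in> space \<omega> \<Longrightarrow> borel_measurable (P z) = borel_measurable \<omega>"
  by (rule measurable_cong_sets[OF sets_P refl])

lemma op_measurable: "f \<in> borel_measurable \<omega> \<Longrightarrow> kernel_op P f \<in> borel_measurable \<omega>"
  by (rule kernel_op_measurable[OF subkernel])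

lemma nn_integral_kernel: "F \<in> borel_measurable \<omega> \<Longrightarrow> (\<integral>\<^sup>+z. \<integral>\<^sup>+w. F w \<partial>P z \<partial>\<omega>) = (\<integral>\<^sup>+z. F z \<partial>\<omega>)"
  using nn_integral_bind[OF _ subkernel, of F] invariant by simp

lemma
  assumes "integrable \<omega> f"
  shows AE_integrable: "AE z in \<omega>. integrable (P z) f"
    and integral_op: "(\<integral>z. kernel_op P f z \<partial>\<omega>) = (\<integral>z. f z \<partial>\<omega>)"
proof -
  have f: "f \<in> borel_measurable \<omega>" and "(\<integral>\<^sup>+z. ennreal \<bar>f z\<bar> \<partial>\<omega>) < \<infinity>"
    using assms by (auto simp: integrable_iff_bounded)
  then have "(\<integral>\<^sup>+z. \<integral>\<^sup>+w. ennreal \<bar>f w\<bar> \<partial>P z \<partial>\<omega>) < \<infinity>"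
    by (subst nn_integral_kernel) auto
  from AE_integrable_bind_kernel[OF subkernel f this not_empty]
    integral_bind_kernel[OF subkernel f this not_empty]
  show "AE z in \<omega>. integrable (P z) f" "(\<integral>z. kernel_op P f z \<partial>\<omega>) = (\<integral>z. f z \<partial>\<omega>)"
    by (simp_all add: invariant)
qed

lemma AE_square_integrable:
  assumes "f \<in> L2 \<omega>"
  shows "AE z in \<omega>. z \<in> space \<omega> \<and> f \<in> L2 (P z) \<and> integrable (P z) f"
  using AE_integrable[OF L2_square_integrable[OF assms]] AE_integrable[OF L2_integrable[OF assms]] AE_space
proof eventually_elim
  case (elim z)
  then show ?case
    using L2_measurable[OF assms] measurable_P[of z] by (auto simp: L2_def)
qed

text \<open>
  By invariance, a null set of \<open>\<omega>\<close> is also null for \<open>P z\<close>, for almost every \<open>z\<close>. Therefore \<open>kernel_op P\<close>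
  acts on almost-everywhere classes.
\<close>

lemma op_cong_AE:
  assumes f: "f \<in> borel_measurable \<omega>" and g: "g \<in> borel_measurable \<omega>" and "AE z in \<omega>. f z = g z"
  shows "AE z in \<omega>. kernel_op P f z = kernel_op P g z"
proof -
  have "AE w in \<omega> \<bind> P. f w = g w"
    unfolding invariant by (rule assms(3))
  moreover have "Measurable.pred \<omega> (\<lambda>w. f w = g w)"
    using f g by simp
  ultimately have "AE z in \<omega>. AE w in P z. f w = g w"
    by (rule AE_bind[OF subkernel, THEN iffD1, rotated])
  then show ?thesis
    using AE_space
  proof eventually_elim
    case (elim z)
    then show ?case
      unfolding kernel_op_def using f g by (intro integral_cong_AE) (auto simp: measurable_P)
  qed
qed

text \<open>
  Jensen's inequality for each probability measure \<open>P z\<close>, integrated against the invariant measure.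
\<close>

lemma
  assumes f: "f \<in> L2 \<omega>"
  shows op_square_integrable: "integrable \<omega> (\<lambda>z. (kernel_op P f z)\<^sup>2)"
    and op_contraction: "(\<integral>z. (kernel_op P f z)\<^sup>2 \<partial>\<omega>) \<le> (\<integral>z. (f z)\<^sup>2 \<partial>\<omega>)"
    and integrable_op_square: "integrable \<omega> (kernel_op P (\<lambda>w. (f w)\<^sup>2))"
proof -
  note f2 = L2_square_integrable[OF f]
  have meas: "kernel_op P f \<in> borel_measurable \<omega>"
    by (rule op_measurable[OF L2_measurable[OF f]])
  have meas2: "kernel_op P (\<lambda>w. (f w)\<^sup>2) \<in> borel_measurable \<omega>"
    using f2 by (intro op_measurable) auto
  have fin: "(\<integral>\<^sup>+z. ennreal ((f z)\<^sup>2) \<partial>\<omega>) < \<infinity>"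
    using f2 by (simp add: integrable_iff_bounded)
  have "(\<integral>\<^sup>+z. ennreal (kernel_op P (\<lambda>w. (f w)\<^sup>2) z) \<partial>\<omega>) = (\<integral>\<^sup>+z. \<integral>\<^sup>+w. ennreal ((f w)\<^sup>2) \<partial>P z \<partial>\<omega>)"
  proof (intro nn_integral_cong_AE)
    show "AE z in \<omega>. ennreal (kernel_op P (\<lambda>w. (f w)\<^sup>2) z) = (\<integral>\<^sup>+w. ennreal ((f w)\<^sup>2) \<partial>P z)"
      using AE_square_integrable[OF f]
      by eventually_elim (auto simp: kernel_op_def L2_def nn_integral_eq_integral)
  qed
  also have "\<dots> = (\<integral>\<^sup>+z. ennreal ((f z)\<^sup>2) \<partial>\<omega>)"
    using f2 by (intro nn_integral_kernel) auto
  finally have eq: "(\<integral>\<^sup>+z. ennreal (kernel_op P (\<lambda>w. (f w)\<^sup>2) z) \<partial>\<omega>) = (\<integral>\<^sup>+z. ennreal ((f z)\<^sup>2) \<partial>\<omega>)" .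
  have nonneg: "0 \<le> kernel_op P (\<lambda>w. (f w)\<^sup>2) z" for z
    by (simp add: kernel_op_def)
  show int2: "integrable \<omega> (kernel_op P (\<lambda>w. (f w)\<^sup>2))"
    using eq fin meas2 nonneg by (simp add: integrable_iff_bounded)
  have jensen: "AE z in \<omega>. (kernel_op P f z)\<^sup>2 \<le> kernel_op P (\<lambda>w. (f w)\<^sup>2) z"
    using AE_square_integrable[OF f]
  proof eventually_elim
    case (elim z)
    then interpret Pz: prob_space "P z"
      using prob_space_P by simp
    have "0 \<le> (\<integral>w. (f w)\<^sup>2 \<partial>P z) - (\<integral>w. f w \<partial>P z)\<^sup>2"
      using elim Pz.variance_positive[of f] Pz.variance_eq[of f] by (simp add: L2_def)
    then show ?case
      by (simp add: kernel_op_def)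
  qed
  show int: "integrable \<omega> (\<lambda>z. (kernel_op P f z)\<^sup>2)"
  proof (rule Bochner_Integration.integrable_bound[OF int2])
    show "(\<lambda>z. (kernel_op P f z)\<^sup>2) \<in> borel_measurable \<omega>"
      using meas by simp
    show "AE z in \<omega>. norm ((kernel_op P f z)\<^sup>2) \<le> norm (kernel_op P (\<lambda>w. (f w)\<^sup>2) z)"
      using jensen by eventually_elim (simp add: nonneg)
  qed
  have "(\<integral>z. (kernel_op P f z)\<^sup>2 \<partial>\<omega>) \<le> (\<integral>z. kernel_op P (\<lambda>w. (f w)\<^sup>2) z \<partial>\<omega>)"
    by (rule integral_mono_AE[OF int int2 jensen])
  then show "(\<integral>z. (kernel_op P f z)\<^sup>2 \<partial>\<omega>) \<le> (\<integral>z. (f z)\<^sup>2 \<partial>\<omega>)"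
    by (simp add: integral_op[OF f2])
qed

lemma op_L2: "f \<in> L2 \<omega> \<Longrightarrow> kernel_op P f \<in> L2 \<omega>"
  using op_square_integrable op_measurable by (auto simp: L2_def)

lemma op_L2_0: "f \<in> L2_0 \<omega> \<Longrightarrow> kernel_op P f \<in> L2_0 \<omega>"
  using op_L2 integral_op L2_integrable by (auto simp: L2_0_def)

lemma op_pow_L2: "f \<in> L2 \<omega> \<Longrightarrow> (kernel_op P ^^ n) f \<in> L2 \<omega>"
  by (induction n) (auto intro: op_L2)

lemma op_pow_L2_0: "f \<in> L2_0 \<omega> \<Longrightarrow> (kernel_op P ^^ n) f \<in> L2_0 \<omega>"
  by (induction n) (auto intro: op_L2_0)

lemma invariant_kernel_bind:
  assumes "invariant_kernel \<omega> Q"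
  shows "invariant_kernel \<omega> (\<lambda>z. P z \<bind> Q)"
proof -
  interpret Q: invariant_kernel \<omega> Q by fact
  show ?thesis
  proof
    show "(\<lambda>z. P z \<bind> Q) \<in> \<omega> \<rightarrow>\<^sub>M prob_algebra \<omega>"
      by (rule measurable_bind_prob_space[OF kernel Q.kernel])
    show "\<omega> \<bind> (\<lambda>z. P z \<bind> Q) = \<omega>"
      using bind_assoc[OF subkernel Q.subkernel, of ] by (simp add: invariant Q.invariant)
  qed
qed

lemma op_bind:
  assumes "invariant_kernel \<omega> Q" and f: "f \<in> L2 \<omega>"
  shows "AE z in \<omega>. kernel_op (\<lambda>z. P z \<bind> Q) f z = kernel_op P (kernel_op Q f) z"
proof -
  interpret Q: invariant_kernel \<omega> Q by fact
  interpret PQ: invariant_kernel \<omega> "\<lambda>z. P z \<bind> Q"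
    by (rule invariant_kernel_bind[OF assms(1)])
  show ?thesis
    using PQ.AE_square_integrable[OF f]
  proof eventually_elim
    case (elim z)
    have Q': "Q \<in> P z \<rightarrow>\<^sub>M subprob_algebra \<omega>"
      using Q.subkernel sets_P[of z] elim by (simp cong: measurable_cong_sets)
    have "(\<integral>\<^sup>+w. ennreal \<bar>f w\<bar> \<partial>(P z \<bind> Q)) < \<infinity>"
      using elim by (auto simp: integrable_iff_bounded)
    then have "(\<integral>\<^sup>+y. \<integral>\<^sup>+w. ennreal \<bar>f w\<bar> \<partial>Q y \<partial>P z) < \<infinity>"
      using L2_measurable[OF f] by (subst (asm) nn_integral_bind[OF _ Q']) auto
    then show ?case
      using integral_bind_kernel[OF Q' L2_measurable[OF f]] elim space_P[of z] not_empty
      by (simp add: kernel_op_def)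
  qed
qed

lemma invariant_kernel_pow: "invariant_kernel \<omega> (kernel_pow \<omega> P n)"
proof (induction n)
  case 0
  show ?case
    by unfold_locales (auto simp: bind_return'')
next
  case (Suc n)
  then show ?case
    by (simp add: invariant_kernel_bind)
qed

text \<open>
  The identity is only claimed almost everywhere: for an exceptional \<open>z\<close> the function \<open>f\<close> need not be
  integrable with respect to the \<open>n\<close>-step distribution, and then default values of the integral enter
  at different places on the two sides.
\<close>

lemma op_kernel_pow:
  assumes f: "f \<in> L2 \<omega>"
  shows "AE z in \<omega>. kernel_op (kernel_pow \<omega> P n) f z = (kernel_op P ^^ n) f z"
proof (induction n)
  case 0
  have "AE z in \<omega>. kernel_op (return \<omega>) f z = f z"
    using L2_measurable[OF f] by (auto simp: kernel_op_def integral_return)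
  then show ?case
    by simp
next
  case (Suc n)
  interpret Pn: invariant_kernel \<omega> "kernel_pow \<omega> P n"
    by (rule invariant_kernel_pow)
  have "AE z in \<omega>. kernel_op P (kernel_op (kernel_pow \<omega> P n) f) z = kernel_op P ((kernel_op P ^^ n) f) z"
    by (intro op_cong_AE Suc L2_measurable Pn.op_L2 op_pow_L2 f)
  with op_bind[OF invariant_kernel_pow[of n] f] show ?case
    by eventually_elim simp
qed

end

section \<open>The convergence rate and the operator norm\<close>

lemma L2_abs: "f \<in> L2 \<omega> \<Longrightarrow> (\<lambda>z. \<bar>f z\<bar>) \<in> L2 \<omega>"
  by (auto simp: L2_def)

context invariant_kernel
begin

text \<open>
  Duality in the form that is needed here: the expectation of \<open>f\<close> after \<open>n\<close> steps from the initial
  distribution \<open>h \<omega>\<close> is an inner product. It translates the distance in the definition of the rate into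
  the language of operators.
\<close>

lemma integral_density_kernel_pow:
  assumes h: "h \<in> L2 \<omega>" and h0: "\<And>z. 0 \<le> h z" and f: "f \<in> L2 \<omega>"
  shows "(\<integral>w. f w \<partial>(density \<omega> (\<lambda>z. ennreal (h z)) \<bind> kernel_pow \<omega> P n)) =
         (\<integral>z. h z * (kernel_op P ^^ n) f z \<partial>\<omega>)"
proof -
  let ?\<mu> = "density \<omega> (\<lambda>z. ennreal (h z))"
  interpret Pn: invariant_kernel \<omega> "kernel_pow \<omega> P n"
    by (rule invariant_kernel_pow)
  have hm: "h \<in> borel_measurable \<omega>" and fm: "f \<in> borel_measurable \<omega>"
    using h f by (simp_all add: L2_def)
  have Pn: "kernel_pow \<omega> P n \<in> ?\<mu> \<rightarrow>\<^sub>M subprob_algebra \<omega>"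
    using Pn.subkernel by simp
  have abs_f: "(\<lambda>w. \<bar>f w\<bar>) \<in> L2 \<omega>"
    using f by (rule L2_abs)
  have meas: "(\<lambda>z. \<integral>\<^sup>+w. ennreal \<bar>f w\<bar> \<partial>kernel_pow \<omega> P n z) \<in> borel_measurable \<omega>"
    using fm by (intro measurable_compose[OF Pn.subkernel] nn_integral_measurable_subprob_algebra) auto
  have "(\<integral>\<^sup>+z. \<integral>\<^sup>+w. ennreal \<bar>f w\<bar> \<partial>kernel_pow \<omega> P n z \<partial>?\<mu>) =
      (\<integral>\<^sup>+z. ennreal (h z) * (\<integral>\<^sup>+w. ennreal \<bar>f w\<bar> \<partial>kernel_pow \<omega> P n z) \<partial>\<omega>)"
    using hm meas by (subst nn_integral_density) auto
  also have "\<dots> = (\<integral>\<^sup>+z. ennreal (h z * kernel_op (kernel_pow \<omega> P n) (\<lambda>w. \<bar>f w\<bar>) z) \<partial>\<omega>)"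
  proof (intro nn_integral_cong_AE)
    show "AE z in \<omega>. ennreal (h z) * (\<integral>\<^sup>+w. ennreal \<bar>f w\<bar> \<partial>kernel_pow \<omega> P n z) =
        ennreal (h z * kernel_op (kernel_pow \<omega> P n) (\<lambda>w. \<bar>f w\<bar>) z)"
      using Pn.AE_square_integrable[OF abs_f]
      by eventually_elim (simp add: kernel_op_def nn_integral_eq_integral ennreal_mult h0)
  qed
  also have "\<dots> < \<infinity>"
    using L2_mult_integrable[OF h Pn.op_L2[OF abs_f]] h0
    by (simp add: integrable_iff_bounded abs_mult kernel_op_def)
  finally have "(\<integral>w. f w \<partial>(?\<mu> \<bind> kernel_pow \<omega> P n)) = (\<integral>z. kernel_op (kernel_pow \<omega> P n) f z \<partial>?\<mu>)"
    by (rule integral_bind_kernel[OF Pn fm]) (simp add: not_empty)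
  also have "\<dots> = (\<integral>z. h z * kernel_op (kernel_pow \<omega> P n) f z \<partial>\<omega>)"
    using hm Pn.op_measurable[OF fm] h0 by (intro integral_real_density) auto
  also have "\<dots> = (\<integral>z. h z * (kernel_op P ^^ n) f z \<partial>\<omega>)"
  proof (rule integral_cong_AE)
    show "AE z in \<omega>. h z * kernel_op (kernel_pow \<omega> P n) f z = h z * (kernel_op P ^^ n) f z"
      using op_kernel_pow[OF f, of n] by eventually_elim simp
  qed (use hm Pn.op_measurable[OF fm] L2_measurable[OF op_pow_L2[OF f]] in auto)
  finally show ?thesis .
qed

lemma op_pow_contraction:
  assumes le: "\<And>f. f \<in> L2_0 \<omega> \<Longrightarrow> (\<integral>z. (kernel_op P f z)\<^sup>2 \<partial>\<omega>) \<le> \<kappa>\<^sup>2 * (\<integral>z. (f z)\<^sup>2 \<partial>\<omega>)"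
    and "0 \<le> \<kappa>" and f: "f \<in> L2_0 \<omega>"
  shows "L2_norm \<omega> ((kernel_op P ^^ n) f) \<le> \<kappa> ^ n * L2_norm \<omega> f"
proof (induction n)
  case (Suc n)
  have "L2_norm \<omega> ((kernel_op P ^^ Suc n) f) \<le> \<kappa> * L2_norm \<omega> ((kernel_op P ^^ n) f)"
  proof (rule power2_le_imp_le)
    show "(L2_norm \<omega> ((kernel_op P ^^ Suc n) f))\<^sup>2 \<le> (\<kappa> * L2_norm \<omega> ((kernel_op P ^^ n) f))\<^sup>2"
      using le[OF op_pow_L2_0[OF f]] by (simp add: L2_norm_square power_mult_distrib)
  qed (simp add: assms)
  also have "\<dots> \<le> \<kappa> * (\<kappa> ^ n * L2_norm \<omega> f)"
    by (rule mult_left_mono[OF Suc \<open>0 \<le> \<kappa>\<close>])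
  finally show ?case
    by (simp add: mult_ac)
qed simp

definition geometric_rates :: "real set" where
  "geometric_rates = {\<rho> \<in> {0..1}. \<forall>\<mu> \<in> L2_star \<omega>. \<exists>C::real. \<forall>n::nat. 0 < n \<longrightarrow>
     L2_dist \<omega> (\<mu> \<bind> kernel_pow \<omega> P n) \<omega> < ennreal (C * \<rho> ^ n)}"

lemma L2_rate_eq: "L2_rate \<omega> P = Inf geometric_rates"
  by (simp add: L2_rate_def geometric_rates_def)

lemma contraction_imp_geometric_rate:
  assumes le: "\<And>f. f \<in> L2_0 \<omega> \<Longrightarrow> (\<integral>z. (kernel_op P f z)\<^sup>2 \<partial>\<omega>) \<le> \<kappa>\<^sup>2 * (\<integral>z. (f z)\<^sup>2 \<partial>\<omega>)"
    and \<kappa>: "0 < \<kappa>" "\<kappa> \<le> 1"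
  shows "\<kappa> \<in> geometric_rates"
proof -
  have "\<exists>C. \<forall>n>0. L2_dist \<omega> (\<mu> \<bind> kernel_pow \<omega> P n) \<omega> < ennreal (C * \<kappa> ^ n)"
    if \<mu>: "\<mu> \<in> L2_star \<omega>" for \<mu>
  proof (intro exI allI impI)
    fix n :: nat
    assume "0 < n"
    define h where "h = (\<lambda>z. enn2real (RN_deriv \<omega> \<mu> z))"
    have h: "h \<in> L2 \<omega>" and ac: "absolutely_continuous \<omega> \<mu>" and sets: "sets \<mu> = sets \<omega>"
      and "prob_space \<mu>"
      using \<mu> by (simp_all add: L2_star_def h_def)
    interpret \<mu>: prob_space \<mu> by fact
    have "density \<omega> (\<lambda>z. ennreal (h z)) = density \<omega> (RN_deriv \<omega> \<mu>)"
    proof (rule density_cong)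
      show "AE z in \<omega>. ennreal (h z) = RN_deriv \<omega> \<mu> z"
        using RN_deriv_finite[OF \<mu>.sigma_finite_measure_axioms ac sets]
        by eventually_elim (simp add: h_def less_top)
    qed (use h in \<open>auto simp: L2_def\<close>)
    then have \<mu>_eq: "\<mu> = density \<omega> (\<lambda>z. ennreal (h z))"
      using density_RN_deriv[OF ac sets] by simp
    have "L2_dist \<omega> (\<mu> \<bind> kernel_pow \<omega> P n) \<omega> \<le> ennreal (L2_norm \<omega> h * \<kappa> ^ n)"
      unfolding L2_dist_def
    proof (intro SUP_least ennreal_leI)
      fix f
      assume "f \<in> {f \<in> L2_0 \<omega>. L2_norm \<omega> f = 1}"
      then have f0: "f \<in> L2_0 \<omega>" and f: "f \<in> L2 \<omega>" and "(\<integral>z. f z \<partial>\<omega>) = 0" and f1: "L2_norm \<omega> f = 1"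
        by (auto simp: L2_0_def)
      then have "\<bar>(\<integral>z. f z \<partial>(\<mu> \<bind> kernel_pow \<omega> P n)) - (\<integral>z. f z \<partial>\<omega>)\<bar> =
          \<bar>\<integral>z. h z * (kernel_op P ^^ n) f z \<partial>\<omega>\<bar>"
        unfolding \<mu>_eq by (subst integral_density_kernel_pow[OF h _ f]) (auto simp: h_def)
      also have "\<dots> \<le> L2_norm \<omega> h * L2_norm \<omega> ((kernel_op P ^^ n) f)"
        by (rule L2_inner_le_norms[OF h op_pow_L2[OF f]])
      also have "\<dots> \<le> L2_norm \<omega> h * (\<kappa> ^ n * L2_norm \<omega> f)"
        using \<kappa> by (intro mult_left_mono op_pow_contraction[OF le _ f0]) auto
      finally show "\<bar>(\<integral>z. f z \<partial>(\<mu> \<bind> kernel_pow \<omega> P n)) - (\<integral>z. f z \<partial>\<omega>)\<bar> \<le> L2_norm \<omega> h * \<kappa> ^ n"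
        by (simp add: f1)
    qed
    \<comment> \<open>The summand 1 makes the inequality strict even if the density has norm 0.\<close>
    also have "\<dots> < ennreal ((L2_norm \<omega> (\<lambda>z. enn2real (RN_deriv \<omega> \<mu> z)) + 1) * \<kappa> ^ n)"
      using \<kappa> by (intro ennreal_lessI) (auto simp: h_def add_nonneg_pos intro!: mult_strict_right_mono)
    finally show "L2_dist \<omega> (\<mu> \<bind> kernel_pow \<omega> P n) \<omega> <
        ennreal ((L2_norm \<omega> (\<lambda>z. enn2real (RN_deriv \<omega> \<mu> z)) + 1) * \<kappa> ^ n)" .
  qed
  then show ?thesis
    using \<kappa> by (simp add: geometric_rates_def)
qed

lemma rate_less_one_if_contraction:
  assumes "\<kappa> < 1"
    and le: "\<And>f. f \<in> L2_0 \<omega> \<Longrightarrow> (\<integral>z. (kernel_op P f z)\<^sup>2 \<partial>\<omega>) \<le> \<kappa> * (\<integral>z. (f z)\<^sup>2 \<partial>\<omega>)"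
  shows "L2_rate \<omega> P < 1"
proof -
  \<comment> \<open>The maximum keeps the rate positive; a strict bound by \<open>C * 0 ^ n\<close> is impossible.\<close>
  define \<rho> where "\<rho> = sqrt (max \<kappa> (1/2))"
  have \<rho>: "0 < \<rho>" "\<rho> < 1" "\<kappa> \<le> \<rho>\<^sup>2"
    using assms(1) by (auto simp: \<rho>_def)
  have "\<rho> \<in> geometric_rates"
  proof (rule contraction_imp_geometric_rate)
    fix f
    assume "f \<in> L2_0 \<omega>"
    then show "(\<integral>z. (kernel_op P f z)\<^sup>2 \<partial>\<omega>) \<le> \<rho>\<^sup>2 * (\<integral>z. (f z)\<^sup>2 \<partial>\<omega>)"
      using \<rho> by (intro order_trans[OF le] mult_right_mono) auto
  qed (use \<rho> in auto)
  moreover have "bdd_below geometric_rates"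
    by (auto simp: geometric_rates_def bdd_below_def)
  ultimately have "Inf geometric_rates \<le> \<rho>"
    by (rule cInf_lower)
  then show ?thesis
    using \<rho> by (simp add: L2_rate_eq)
qed

text \<open>
  A nonnegative \<open>h\<close> with positive integral is, up to normalization, the density of an initial
  distribution in \<open>L2_star \<omega>\<close>, to which the definition of the rate applies.
\<close>

lemma weak_decay_nonneg:
  assumes \<rho>: "\<rho> \<in> geometric_rates" and h: "h \<in> L2 \<omega>" and h0: "\<And>z. 0 \<le> h z"
  shows "\<exists>C. \<forall>n>0. \<forall>f \<in> L2_0 \<omega>.
    \<bar>\<integral>z. h z * (kernel_op P ^^ n) f z \<partial>\<omega>\<bar> \<le> C * \<rho> ^ n * L2_norm \<omega> f"
proof -
  define m where "m = (\<integral>z. h z \<partial>\<omega>)"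
  have m0: "0 \<le> m"
    by (simp add: m_def h0)
  have hi: "integrable \<omega> h" and hm: "h \<in> borel_measurable \<omega>"
    using L2_integrable[OF h] L2_measurable[OF h] by simp_all
  show ?thesis
  proof (cases "m = 0")
    case True
    then have "AE z in \<omega>. h z = 0"
      using integral_nonneg_eq_0_iff_AE[OF hi] h0 by (simp add: m_def)
    then have "(\<integral>z. h z * g z \<partial>\<omega>) = 0" for g
      by (intro integral_eq_zero_AE) (auto elim: eventually_mono)
    then show ?thesis
      by (intro exI[of _ 0]) simp
  next
    case False
    then have m: "0 < m"
      using m0 by simp
    define h' where "h' = (\<lambda>z. h z / m)"
    have h'0: "0 \<le> h' z" for z
      using m h0 by (simp add: h'_def)
    have h': "h' \<in> L2 \<omega>"
      using L2_linear[OF h h, of "1 / m" 0] by (simp add: h'_def)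
    have h'm: "h' \<in> borel_measurable \<omega>"
      using h' by (simp add: L2_def)
    define \<mu> where "\<mu> = density \<omega> (\<lambda>z. ennreal (h' z))"
    have "(\<integral>\<^sup>+z. ennreal (h' z) \<partial>\<omega>) = ennreal (\<integral>z. h' z \<partial>\<omega>)"
      using h'0 L2_integrable[OF h'] by (intro nn_integral_eq_integral) auto
    also have "\<dots> = 1"
      using m by (simp add: h'_def m_def)
    finally have "prob_space \<mu>"
      unfolding \<mu>_def using h'm by (intro prob_spaceI) (simp add: emeasure_density cong: nn_integral_cong_simp)
    moreover have AE_h': "AE z in \<omega>. ennreal (h' z) = RN_deriv \<omega> \<mu> z"
      using h'm by (intro RN_deriv_unique) (auto simp: \<mu>_def)
    have "(\<lambda>z. enn2real (RN_deriv \<omega> \<mu> z)) \<in> L2 \<omega>"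
    proof -
      have "integrable \<omega> (\<lambda>z. (enn2real (RN_deriv \<omega> \<mu> z))\<^sup>2) \<longleftrightarrow> integrable \<omega> (\<lambda>z. (h' z)\<^sup>2)"
      proof (rule integrable_cong_AE)
        show "AE z in \<omega>. (enn2real (RN_deriv \<omega> \<mu> z))\<^sup>2 = (h' z)\<^sup>2"
          using AE_h' by eventually_elim (metis enn2real_ennreal h'0)
      qed (use h'm in auto)
      then show ?thesis
        using h' by (simp add: L2_def)
    qed
    moreover have "absolutely_continuous \<omega> \<mu>"
      unfolding \<mu>_def using h'm by (intro absolutely_continuousI_density) auto
    ultimately have "\<mu> \<in> L2_star \<omega>"
      by (simp add: L2_star_def \<mu>_def)
    then obtain C where C: "L2_dist \<omega> (\<mu> \<bind> kernel_pow \<omega> P n) \<omega> < ennreal (C * \<rho> ^ n)" if "0 < n" for n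
      using \<rho> unfolding geometric_rates_def by blast
    have "\<bar>\<integral>z. h z * (kernel_op P ^^ n) f z \<partial>\<omega>\<bar> \<le> (m * C) * \<rho> ^ n * L2_norm \<omega> f"
      if n: "0 < n" and f0: "f \<in> L2_0 \<omega>" for n f
    proof (cases "L2_norm \<omega> f = 0")
      case True
      have f: "f \<in> L2 \<omega>"
        using f0 by (simp add: L2_0_def)
      have "L2_norm \<omega> ((kernel_op P ^^ n) f) \<le> 1 ^ n * L2_norm \<omega> f"
        by (rule op_pow_contraction[OF _ _ f0]) (auto simp: L2_0_def op_contraction)
      then have "L2_norm \<omega> ((kernel_op P ^^ n) f) = 0"
        using True L2_norm_nonneg[of \<omega> "(kernel_op P ^^ n) f"] by simp
      then show ?thesis
        using L2_inner_le_norms[OF h op_pow_L2[OF f, of n]] True by simp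
    next
      case False
      define N where "N = L2_norm \<omega> f"
      have N: "0 < N"
        using False L2_norm_nonneg[of \<omega> f] unfolding N_def by linarith
      define g where "g = (\<lambda>z. f z / N)"
      have f: "f \<in> L2 \<omega>" and "(\<integral>z. f z \<partial>\<omega>) = 0"
        using f0 by (simp_all add: L2_0_def)
      then have g: "g \<in> L2 \<omega>" and g_int: "(\<integral>z. g z \<partial>\<omega>) = 0"
        using L2_linear[OF f f, of "1 / N" 0] by (simp_all add: g_def)
      have "(\<integral>z. (g z)\<^sup>2 \<partial>\<omega>) = (\<integral>z. (f z)\<^sup>2 \<partial>\<omega>) / N\<^sup>2"
        by (simp add: g_def power_divide)
      also have "\<dots> = 1"
        using N by (simp add: L2_norm_square[symmetric] N_def)
      finally have "L2_norm \<omega> g = 1"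
        by (simp add: L2_norm_def)
      then have "ennreal \<bar>(\<integral>z. g z \<partial>(\<mu> \<bind> kernel_pow \<omega> P n)) - (\<integral>z. g z \<partial>\<omega>)\<bar> < ennreal (C * \<rho> ^ n)"
        using g g_int
        by (intro le_less_trans[OF _ C[OF n]]) (auto simp: L2_dist_def L2_0_def intro!: SUP_upper2[of g])
      then have "\<bar>\<integral>z. g z \<partial>(\<mu> \<bind> kernel_pow \<omega> P n)\<bar> < C * \<rho> ^ n"
        by (simp add: g_int ennreal_less_iff)
      also have "(\<integral>z. g z \<partial>(\<mu> \<bind> kernel_pow \<omega> P n)) = (\<integral>z. f z \<partial>(\<mu> \<bind> kernel_pow \<omega> P n)) / N"
        by (simp add: g_def)
      also have "(\<integral>z. f z \<partial>(\<mu> \<bind> kernel_pow \<omega> P n)) = (\<integral>z. h z * (kernel_op P ^^ n) f z \<partial>\<omega>) / m"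
        unfolding \<mu>_def by (subst integral_density_kernel_pow[OF h' h'0 f]) (simp add: h'_def)
      finally show ?thesis
        using m N by (simp add: N_def[symmetric] field_simps abs_mult)
    qed
    then show ?thesis
      by blast
  qed
qed

text \<open>
  The constant depends on \<open>h\<close>, so this says less than decay of the operator norms of the powers.
  An arbitrary \<open>h\<close> is the difference of its positive and negative part.
\<close>

lemma weak_decay:
  assumes "L2_rate \<omega> P < 1"
  shows "\<exists>\<rho>. 0 \<le> \<rho> \<and> \<rho> < 1 \<and> (\<forall>h \<in> L2 \<omega>. \<exists>C. \<forall>n>0. \<forall>f \<in> L2_0 \<omega>.
    \<bar>\<integral>z. h z * (kernel_op P ^^ n) f z \<partial>\<omega>\<bar> \<le> C * \<rho> ^ n * L2_norm \<omega> f)"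
proof -
  \<comment> \<open>This rules out an empty set of rates, whose infimum would be unspecified.\<close>
  have "1 \<in> geometric_rates"
    by (rule contraction_imp_geometric_rate) (auto simp: L2_0_def op_contraction)
  then obtain \<rho> where \<rho>: "\<rho> \<in> geometric_rates" "\<rho> < 1"
    using cInf_lessD[of geometric_rates 1] assms by (auto simp: L2_rate_eq)
  have "\<exists>C. \<forall>n>0. \<forall>f \<in> L2_0 \<omega>. \<bar>\<integral>z. h z * (kernel_op P ^^ n) f z \<partial>\<omega>\<bar> \<le> C * \<rho> ^ n * L2_norm \<omega> f"
    if h: "h \<in> L2 \<omega>" for h
  proof -
    define p m where "p = (\<lambda>z. (\<bar>h z\<bar> + h z) / 2)" and "m = (\<lambda>z. (\<bar>h z\<bar> - h z) / 2)"
    have abs_h: "(\<lambda>z. \<bar>h z\<bar>) \<in> L2 \<omega>"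
      using h by (rule L2_abs)
    have p: "p \<in> L2 \<omega>" and m: "m \<in> L2 \<omega>"
      using L2_linear[OF abs_h h, of "1 / 2" "1 / 2"] L2_linear[OF abs_h h, of "1 / 2" "- 1 / 2"]
      by (simp_all add: p_def m_def field_simps)
    have p0: "0 \<le> p z" and m0: "0 \<le> m z" for z
      by (auto simp: p_def m_def)
    obtain A where
      A: "\<forall>n>0. \<forall>f \<in> L2_0 \<omega>. \<bar>\<integral>z. p z * (kernel_op P ^^ n) f z \<partial>\<omega>\<bar> \<le> A * \<rho> ^ n * L2_norm \<omega> f"
      using weak_decay_nonneg[OF \<rho>(1) p p0] by blast
    obtain B where
      B: "\<forall>n>0. \<forall>f \<in> L2_0 \<omega>. \<bar>\<integral>z. m z * (kernel_op P ^^ n) f z \<partial>\<omega>\<bar> \<le> B * \<rho> ^ n * L2_norm \<omega> f"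
      using weak_decay_nonneg[OF \<rho>(1) m m0] by blast
    have "\<bar>\<integral>z. h z * (kernel_op P ^^ n) f z \<partial>\<omega>\<bar> \<le> (A + B) * \<rho> ^ n * L2_norm \<omega> f"
      if n: "0 < n" and f: "f \<in> L2_0 \<omega>" for n f
    proof -
      have Pf: "(kernel_op P ^^ n) f \<in> L2 \<omega>"
        using f by (intro op_pow_L2) (simp add: L2_0_def)
      have "(\<integral>z. h z * (kernel_op P ^^ n) f z \<partial>\<omega>) =
          (\<integral>z. p z * (kernel_op P ^^ n) f z - m z * (kernel_op P ^^ n) f z \<partial>\<omega>)"
        by (rule Bochner_Integration.integral_cong) (auto simp: p_def m_def field_simps)
      also have "\<dots> = (\<integral>z. p z * (kernel_op P ^^ n) f z \<partial>\<omega>) - (\<integral>z. m z * (kernel_op P ^^ n) f z \<partial>\<omega>)"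
        by (intro Bochner_Integration.integral_diff L2_mult_integrable p m Pf)
      finally show ?thesis
        using A[rule_format, OF n f] B[rule_format, OF n f] by (simp add: algebra_simps)
    qed
    then show ?thesis
      by blast
  qed
  then show ?thesis
    using \<rho> by (intro exI[of _ \<rho>]) (auto simp: geometric_rates_def)
qed

end

text \<open>
  The variance of \<open>f\<close> under \<open>P z\<close> is \<open>\<integral> (f - a)\<^sup>2 \<partial>P z\<close> for the mean \<open>a\<close> of \<open>f\<close> under \<open>P z\<close>. By domination it
  is at least \<open>c \<integral> (f - a)\<^sup>2 \<partial>Q z\<close>, and replacing \<open>a\<close> by the mean under \<open>Q z\<close> only decreases that integral. So
  the conditional variances satisfy \<open>Var\<^sub>P \<ge> c Var\<^sub>Q\<close> pointwise. Integration over the common invariant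
  measure gives \<open>\<parallel>f\<parallel>\<^sup>2 - \<parallel>P f\<parallel>\<^sup>2 \<ge> c (\<parallel>f\<parallel>\<^sup>2 - \<parallel>Q f\<parallel>\<^sup>2)\<close>.
\<close>

lemma rate_less_one_if_minorized:
  assumes "invariant_kernel \<omega> P" and "invariant_kernel \<omega> Q"
    and c: "0 < c"
    and minor: "\<And>z A. z \<in> space \<omega> \<Longrightarrow> A \<in> sets \<omega> \<Longrightarrow> ennreal c * emeasure (Q z) A \<le> emeasure (P z) A"
    and \<kappa>: "\<kappa> < 1"
    and le: "\<And>f. f \<in> L2_0 \<omega> \<Longrightarrow> (\<integral>z. (kernel_op Q f z)\<^sup>2 \<partial>\<omega>) \<le> \<kappa> * (\<integral>z. (f z)\<^sup>2 \<partial>\<omega>)"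
  shows "L2_rate \<omega> P < 1"
proof -
  interpret P: invariant_kernel \<omega> P by fact
  interpret Q: invariant_kernel \<omega> Q by fact
  show ?thesis
  proof (rule P.rate_less_one_if_contraction)
    show "1 - c * (1 - \<kappa>) < 1"
      using c \<kappa> by simp
    fix f
    assume f0: "f \<in> L2_0 \<omega>"
    then have f: "f \<in> L2 \<omega>"
      by (simp add: L2_0_def)
    have variance_le: "AE z in \<omega>. (kernel_op P f z)\<^sup>2 \<le>
        kernel_op P (\<lambda>w. (f w)\<^sup>2) z - c * kernel_op Q (\<lambda>w. (f w)\<^sup>2) z + c * (kernel_op Q f z)\<^sup>2"
      using P.AE_square_integrable[OF f] Q.AE_square_integrable[OF f]
    proof eventually_elim
      case (elim z)
      then interpret Pz: prob_space "P z"
        using P.prob_space_P by simp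
      from elim interpret Qz: prob_space "Q z"
        using Q.prob_space_P by simp
      define a where "a = kernel_op P f z"
      have square: "integrable R (\<lambda>w. (f w - a)\<^sup>2)"
          "(\<integral>w. (f w - a)\<^sup>2 \<partial>R) = (\<integral>w. (f w)\<^sup>2 \<partial>R) - 2 * a * (\<integral>w. f w \<partial>R) + a\<^sup>2"
        if "prob_space R" "integrable R f" "f \<in> L2 R" for R
      proof -
        interpret prob_space R by fact
        have "(\<lambda>w. (f w - a)\<^sup>2) = (\<lambda>w. (f w)\<^sup>2 - 2 * a * f w + a\<^sup>2)"
          by (auto simp: power2_diff algebra_simps)
        then show "integrable R (\<lambda>w. (f w - a)\<^sup>2)"
          "(\<integral>w. (f w - a)\<^sup>2 \<partial>R) = (\<integral>w. (f w)\<^sup>2 \<partial>R) - 2 * a * (\<integral>w. f w \<partial>R) + a\<^sup>2"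
          using that by (simp_all add: L2_def prob_space)
      qed
      have sets: "sets (scale_measure (ennreal c) (Q z)) = sets (P z)"
        using elim by (simp add: P.sets_P Q.sets_P)
      have "scale_measure (ennreal c) (Q z) \<le> P z"
        using minor elim by (subst le_measure[OF sets]) (auto simp: P.sets_P Q.sets_P)
      then have "(\<integral>\<^sup>+w. ennreal ((f w - a)\<^sup>2) \<partial>scale_measure (ennreal c) (Q z)) \<le>
          (\<integral>\<^sup>+w. ennreal ((f w - a)\<^sup>2) \<partial>P z)"
        by (rule nn_integral_mono_measure[OF sets])
      then have "ennreal c * (\<integral>\<^sup>+w. ennreal ((f w - a)\<^sup>2) \<partial>Q z) \<le> (\<integral>\<^sup>+w. ennreal ((f w - a)\<^sup>2) \<partial>P z)"
        using elim by (subst (asm) nn_integral_scale_measure) auto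
      then have "ennreal (c * (\<integral>w. (f w - a)\<^sup>2 \<partial>Q z)) \<le> ennreal (\<integral>w. (f w - a)\<^sup>2 \<partial>P z)"
        using elim square(1)[OF Pz.prob_space_axioms] square(1)[OF Qz.prob_space_axioms] c
        by (simp add: nn_integral_eq_integral ennreal_mult)
      then have "c * (\<integral>w. (f w - a)\<^sup>2 \<partial>Q z) \<le> (\<integral>w. (f w - a)\<^sup>2 \<partial>P z)"
        by (subst (asm) ennreal_le_iff) auto
      then have "c * (kernel_op Q (\<lambda>w. (f w)\<^sup>2) z - 2 * a * kernel_op Q f z + a\<^sup>2) \<le>
          kernel_op P (\<lambda>w. (f w)\<^sup>2) z - a\<^sup>2"
        using elim square(2)[OF Pz.prob_space_axioms] square(2)[OF Qz.prob_space_axioms]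
        by (simp add: kernel_op_def a_def power2_eq_square)
      moreover have "c * (kernel_op Q (\<lambda>w. (f w)\<^sup>2) z - (kernel_op Q f z)\<^sup>2) \<le>
          c * (kernel_op Q (\<lambda>w. (f w)\<^sup>2) z - 2 * a * kernel_op Q f z + a\<^sup>2)"
        using c zero_le_power2[of "kernel_op Q f z - a"]
        by (intro mult_left_mono) (auto simp: power2_diff algebra_simps)
      ultimately show ?case
        by (simp add: a_def algebra_simps)
    qed
    note f2 = L2_square_integrable[OF f]
    have "(\<integral>z. (kernel_op P f z)\<^sup>2 \<partial>\<omega>) \<le>
        (\<integral>z. kernel_op P (\<lambda>w. (f w)\<^sup>2) z - c * kernel_op Q (\<lambda>w. (f w)\<^sup>2) z + c * (kernel_op Q f z)\<^sup>2 \<partial>\<omega>)"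
      using P.op_square_integrable[OF f] Q.op_square_integrable[OF f]
        P.integrable_op_square[OF f] Q.integrable_op_square[OF f] variance_le
      by (intro integral_mono_AE) auto
    also have "\<dots> = (\<integral>z. (f z)\<^sup>2 \<partial>\<omega>) - c * (\<integral>z. (f z)\<^sup>2 \<partial>\<omega>) + c * (\<integral>z. (kernel_op Q f z)\<^sup>2 \<partial>\<omega>)"
      using P.op_square_integrable[OF f] Q.op_square_integrable[OF f]
        P.integrable_op_square[OF f] Q.integrable_op_square[OF f]
      by (simp add: P.integral_op[OF f2] Q.integral_op[OF f2])
    also have "\<dots> \<le> (\<integral>z. (f z)\<^sup>2 \<partial>\<omega>) - c * (\<integral>z. (f z)\<^sup>2 \<partial>\<omega>) + c * (\<kappa> * (\<integral>z. (f z)\<^sup>2 \<partial>\<omega>))"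
      using c le[OF f0] by simp
    finally show "(\<integral>z. (kernel_op P f z)\<^sup>2 \<partial>\<omega>) \<le> (1 - c * (1 - \<kappa>)) * (\<integral>z. (f z)\<^sup>2 \<partial>\<omega>)"
      by (simp add: algebra_simps)
  qed
qed

section \<open>From weak decay to a contraction\<close>

text \<open>
  The ratios \<open>a (n + 1) / a n\<close> increase with \<open>n\<close>. If the first one exceeded \<open>s\<close>, the sequence would grow
  at least like a geometric sequence with a ratio above \<open>s\<close>.
\<close>

lemma log_convex_first_ratio:
  fixes a :: "nat \<Rightarrow> real"
  assumes nonneg: "\<And>n. 0 \<le> a n" and convex: "\<And>n. (a (Suc n))\<^sup>2 \<le> a n * a (Suc (Suc n))"
    and s: "0 \<le> s" and decay: "\<And>n. 0 < n \<Longrightarrow> a n \<le> K * s ^ n"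
  shows "a 1 \<le> s * a 0"
proof (rule ccontr)
  assume "\<not> a 1 \<le> s * a 0"
  then have less: "s * a 0 < a 1"
    by simp
  then have a1: "0 < a 1"
    using s nonneg[of 0] by (meson le_less_trans mult_nonneg_nonneg)
  have "a 0 \<noteq> 0"
    using convex[of 0] a1 by auto
  then have a0: "0 < a 0"
    using nonneg[of 0] by simp
  define t where "t = a 1 / a 0"
  have st: "s < t" and t: "0 < t"
    using less a0 a1 by (simp_all add: t_def field_simps)
  have step: "0 < a n \<and> t * a n \<le> a (Suc n)" for n
  proof (induction n)
    case 0
    show ?case
      using a0 by (simp add: t_def)
  next
    case (Suc n)
    then have pos: "0 < a (Suc n)"
      using t by (meson less_le_trans mult_pos_pos)
    have "(t * a n) * a (Suc n) \<le> (a (Suc n))\<^sup>2"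
      using Suc pos by (simp add: power2_eq_square)
    also have "\<dots> \<le> a n * a (Suc (Suc n))"
      by (rule convex)
    finally have "a n * (t * a (Suc n)) \<le> a n * a (Suc (Suc n))"
      by (simp add: mult_ac)
    then show ?case
      using Suc pos by simp
  qed
  have lower: "t ^ n * a 0 \<le> a n" for n
  proof (induction n)
    case (Suc n)
    have "t ^ Suc n * a 0 \<le> t * a n"
      using Suc t by (simp add: mult.assoc)
    then show ?case
      using step[of n] by linarith
  qed simp
  show False
  proof (cases "s = 0")
    case True
    then show False
      using decay[of 1] a1 by simp
  next
    case False
    then have s: "0 < s"
      using s by simp
    have "1 < t / s"
      using st s by simp
    then obtain N where N: "K / a 0 < (t / s) ^ N"
      using real_arch_pow by blast
    also have "(t / s) ^ N \<le> (t / s) ^ Suc N"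
      using \<open>1 < t / s\<close> by (intro power_increasing) auto
    finally have "K * s ^ Suc N < t ^ Suc N * a 0"
      using s a0 by (simp add: power_divide divide_simps mult_ac)
    then show False
      using decay[of "Suc N"] lower[of "Suc N"] by simp
  qed
qed

text \<open>
  The shift condition says that \<open>\<integral> u m \<sqdot> u n\<close> depends on \<open>m + n\<close> only, as it does for \<open>u n = T\<^sup>n f\<close> with a
  self-adjoint \<open>T\<close>. Then \<open>\<parallel>u n\<parallel>\<^sup>2 = \<integral> u 0 \<sqdot> u (2 n)\<close>, so weak decay against the single function \<open>u 0\<close>
  controls norms, and the Cauchy-Schwarz inequality gives log-convexity. Speaking of a sequence
  instead of an operator leaves room for identities that hold only almost everywhere.
\<close>

lemma hankel_first_step:
  fixes u :: "nat \<Rightarrow> 'a \<Rightarrow> real"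
  assumes u: "\<And>n. u n \<in> L2 \<omega>"
    and shift: "\<And>m n. (\<integral>z. u (Suc m) z * u n z \<partial>\<omega>) = (\<integral>z. u m z * u (Suc n) z \<partial>\<omega>)"
    and decay: "\<And>n. 0 < n \<Longrightarrow> \<bar>\<integral>z. u 0 z * u n z \<partial>\<omega>\<bar> \<le> K * \<rho> ^ n"
  shows "(\<integral>z. (u 1 z)\<^sup>2 \<partial>\<omega>) \<le> \<rho>\<^sup>2 * (\<integral>z. (u 0 z)\<^sup>2 \<partial>\<omega>)"
proof (rule log_convex_first_ratio[where a = "\<lambda>n. \<integral>z. (u n z)\<^sup>2 \<partial>\<omega>" and K = K])
  fix n
  have "(\<integral>z. (u (Suc n) z)\<^sup>2 \<partial>\<omega>) = (\<integral>z. u n z * u (Suc (Suc n)) z \<partial>\<omega>)"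
    using shift[of n "Suc n"] by (simp add: power2_eq_square)
  then show "(\<integral>z. (u (Suc n) z)\<^sup>2 \<partial>\<omega>)\<^sup>2 \<le> (\<integral>z. (u n z)\<^sup>2 \<partial>\<omega>) * (\<integral>z. (u (Suc (Suc n)) z)\<^sup>2 \<partial>\<omega>)"
    using L2_Cauchy_Schwarz[OF u[of n] u[of "Suc (Suc n)"]] by simp
next
  fix n :: nat
  assume n: "0 < n"
  have "(\<integral>z. u m z * u k z \<partial>\<omega>) = (\<integral>z. u 0 z * u (m + k) z \<partial>\<omega>)" for m k
    by (induction m arbitrary: k) (simp_all add: shift)
  from this[of n n] have "(\<integral>z. (u n z)\<^sup>2 \<partial>\<omega>) = (\<integral>z. u 0 z * u (2 * n) z \<partial>\<omega>)"
    by (simp add: power2_eq_square mult_2)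
  also have "\<dots> \<le> K * \<rho> ^ (2 * n)"
    using decay[of "2 * n"] n by simp
  finally show "(\<integral>z. (u n z)\<^sup>2 \<partial>\<omega>) \<le> K * (\<rho>\<^sup>2) ^ n"
    by (simp add: power_mult)
qed simp_all

lemma (in invariant_kernel) contraction_if_self_adjoint:
  assumes rate: "L2_rate \<omega> P < 1"
    and self_adjoint: "\<And>f g. f \<in> L2 \<omega> \<Longrightarrow> g \<in> L2 \<omega> \<Longrightarrow>
      (\<integral>z. kernel_op P f z * g z \<partial>\<omega>) = (\<integral>z. f z * kernel_op P g z \<partial>\<omega>)"
  shows "\<exists>\<kappa><1. \<forall>f \<in> L2_0 \<omega>. (\<integral>z. (kernel_op P f z)\<^sup>2 \<partial>\<omega>) \<le> \<kappa> * (\<integral>z. (f z)\<^sup>2 \<partial>\<omega>)"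
proof -
  obtain \<rho> where \<rho>: "0 \<le> \<rho>" "\<rho> < 1" and decay: "\<forall>h \<in> L2 \<omega>. \<exists>C. \<forall>n>0. \<forall>f \<in> L2_0 \<omega>.
      \<bar>\<integral>z. h z * (kernel_op P ^^ n) f z \<partial>\<omega>\<bar> \<le> C * \<rho> ^ n * L2_norm \<omega> f"
    using weak_decay[OF rate] by blast
  have "(\<integral>z. (kernel_op P f z)\<^sup>2 \<partial>\<omega>) \<le> \<rho>\<^sup>2 * (\<integral>z. (f z)\<^sup>2 \<partial>\<omega>)" if f0: "f \<in> L2_0 \<omega>" for f
  proof -
    have f: "f \<in> L2 \<omega>"
      using f0 by (simp add: L2_0_def)
    obtain C where C: "\<forall>n>0. \<forall>g \<in> L2_0 \<omega>.
        \<bar>\<integral>z. f z * (kernel_op P ^^ n) g z \<partial>\<omega>\<bar> \<le> C * \<rho> ^ n * L2_norm \<omega> g"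
      using decay f by blast
    have "(\<integral>z. ((kernel_op P ^^ 1) f z)\<^sup>2 \<partial>\<omega>) \<le> \<rho>\<^sup>2 * (\<integral>z. ((kernel_op P ^^ 0) f z)\<^sup>2 \<partial>\<omega>)"
    proof (rule hankel_first_step[where K = "C * L2_norm \<omega> f"])
      show "(kernel_op P ^^ n) f \<in> L2 \<omega>" for n
        by (rule op_pow_L2[OF f])
      show "(\<integral>z. (kernel_op P ^^ Suc m) f z * (kernel_op P ^^ n) f z \<partial>\<omega>) =
          (\<integral>z. (kernel_op P ^^ m) f z * (kernel_op P ^^ Suc n) f z \<partial>\<omega>)" for m n
        using self_adjoint[OF op_pow_L2[OF f, of m] op_pow_L2[OF f, of n]] by simp
      show "\<bar>\<integral>z. (kernel_op P ^^ 0) f z * (kernel_op P ^^ n) f z \<partial>\<omega>\<bar> \<le> C * L2_norm \<omega> f * \<rho> ^ n"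
        if "0 < n" for n
        using C[rule_format, OF that f0] by (simp add: mult_ac)
    qed
    then show ?thesis
      by simp
  qed
  moreover have "\<rho>\<^sup>2 < 1"
    using \<rho> by (simp add: power_less_one_iff)
  ultimately show ?thesis
    by blast
qed

section \<open>Averaging kernels\<close>

text \<open>
  The averaging identity \<open>E (E f \<sqdot> g) = E f \<sqdot> E g\<close> is the pull-out property of a conditional expectation. It
  encodes that
  \<open>P z\<close> lives on the set of points with the same kernel as \<open>z\<close>. That set need not be measurable, since
  points of the component spaces need not be, whereas the identity is meaningful in every
  measurable space.
\<close>

locale averaging_kernel = invariant_kernel +
  assumes averaging: "\<And>f g z. f \<in> borel_measurable \<omega> \<Longrightarrow> g \<in> borel_measurable \<omega> \<Longrightarrow> z \<in> space \<omega> \<Longrightarrow>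
    kernel_op P (\<lambda>w. kernel_op P f w * g w) z = kernel_op P f z * kernel_op P g z"
begin

lemma op_idempotent:
  assumes "f \<in> borel_measurable \<omega>" "z \<in> space \<omega>"
  shows "kernel_op P (kernel_op P f) z = kernel_op P f z"
proof -
  interpret Pz: prob_space "P z"
    using assms(2) by (rule prob_space_P)
  show ?thesis
    using averaging[OF assms(1) _ assms(2), of "\<lambda>_. 1"] by (simp add: kernel_op_def Pz.prob_space)
qed

text \<open>
  Invariance and the averaging identity turn \<open>\<integral> E f \<sqdot> g\<close> into the symmetric expression \<open>\<integral> E f \<sqdot> E g\<close>.
\<close>

lemma op_self_adjoint:
  assumes f: "f \<in> L2 \<omega>" and g: "g \<in> L2 \<omega>"
  shows "(\<integral>z. kernel_op P f z * g z \<partial>\<omega>) = (\<integral>z. f z * kernel_op P g z \<partial>\<omega>)"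
proof -
  have *: "(\<integral>z. kernel_op P f z * g z \<partial>\<omega>) = (\<integral>z. kernel_op P f z * kernel_op P g z \<partial>\<omega>)"
    if "f \<in> L2 \<omega>" "g \<in> L2 \<omega>" for f g
  proof -
    have "(\<integral>z. kernel_op P f z * g z \<partial>\<omega>) = (\<integral>z. kernel_op P (\<lambda>w. kernel_op P f w * g w) z \<partial>\<omega>)"
      using that by (intro integral_op[symmetric] L2_mult_integrable op_L2)
    also have "\<dots> = (\<integral>z. kernel_op P f z * kernel_op P g z \<partial>\<omega>)"
      using that by (intro Bochner_Integration.integral_cong averaging) (auto simp: L2_def)
    finally show ?thesis .
  qed
  show ?thesis
    using *[OF f g] *[OF g f] by (simp add: mult.commute)
qed

end

text \<open>
  Write \<open>E\<^sub>X\<close> and \<open>E\<^sub>Y\<close> for the two projections, so that \<open>P = E\<^sub>X E\<^sub>Y\<close>. The functions \<open>u n = E\<^sub>Y P\<^sup>n g\<close> are, up to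
  null sets, the iterates of the self-adjoint operator \<open>E\<^sub>Y E\<^sub>X E\<^sub>Y\<close> on \<open>u 0 = E\<^sub>Y g\<close>, and
  \<open>\<integral> u 0 \<sqdot> u n = \<integral> u 0 \<sqdot> P\<^sup>n g\<close> decays with the powers of \<open>P\<close>. Hence \<open>\<parallel>u 1\<parallel> \<le> \<rho> \<parallel>u 0\<parallel>\<close>, and
  \<open>\<parallel>P g\<parallel>\<^sup>2 = \<parallel>E\<^sub>X (u 0)\<parallel>\<^sup>2 = \<integral> u 0 \<sqdot> u 1 \<le> \<rho> \<parallel>g\<parallel>\<^sup>2\<close>. The bound is \<open>\<rho>\<close> rather than \<open>\<rho>\<^sup>2\<close>, because the norm of
  \<open>E\<^sub>X E\<^sub>Y\<close> is the square root of its spectral radius.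
\<close>

lemma contraction_alternating:
  assumes "averaging_kernel \<omega> X" and "averaging_kernel \<omega> Y"
    and rate: "L2_rate \<omega> (\<lambda>z. X z \<bind> Y) < 1"
  shows "\<exists>\<kappa><1. \<forall>f \<in> L2_0 \<omega>.
    (\<integral>z. (kernel_op (\<lambda>z. X z \<bind> Y) f z)\<^sup>2 \<partial>\<omega>) \<le> \<kappa> * (\<integral>z. (f z)\<^sup>2 \<partial>\<omega>)"
proof -
  interpret X: averaging_kernel \<omega> X by fact
  interpret Y: averaging_kernel \<omega> Y by fact
  define P where "P = (\<lambda>z. X z \<bind> Y)"
  interpret P: invariant_kernel \<omega> P
    unfolding P_def by (rule X.invariant_kernel_bind) (rule Y.invariant_kernel_axioms)
  have op_P: "AE z in \<omega>. kernel_op P f z = kernel_op X (kernel_op Y f) z" if "f \<in> L2 \<omega>" for f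
    unfolding P_def by (rule X.op_bind[OF Y.invariant_kernel_axioms that])
  obtain \<rho> where \<rho>: "0 \<le> \<rho>" "\<rho> < 1" and decay: "\<forall>h \<in> L2 \<omega>. \<exists>C. \<forall>n>0. \<forall>f \<in> L2_0 \<omega>.
      \<bar>\<integral>z. h z * (kernel_op P ^^ n) f z \<partial>\<omega>\<bar> \<le> C * \<rho> ^ n * L2_norm \<omega> f"
    using P.weak_decay rate by (auto simp: P_def)
  have "(\<integral>z. (kernel_op P g z)\<^sup>2 \<partial>\<omega>) \<le> \<rho> * (\<integral>z. (g z)\<^sup>2 \<partial>\<omega>)" if g0: "g \<in> L2_0 \<omega>" for g
  proof -
    have g: "g \<in> L2 \<omega>"
      using g0 by (simp add: L2_0_def)
    define v u where "v = (\<lambda>n. (kernel_op P ^^ n) g)" and "u = (\<lambda>n. kernel_op Y (v n))"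
    have v: "v n \<in> L2 \<omega>" for n
      by (simp add: v_def P.op_pow_L2[OF g])
    have u: "u n \<in> L2 \<omega>" for n
      by (simp add: u_def Y.op_L2[OF v])
    have Xu: "kernel_op X (u n) \<in> L2 \<omega>" for n
      by (rule X.op_L2[OF u])
    have YXu: "kernel_op Y (kernel_op X (u n)) \<in> L2 \<omega>" for n
      by (rule Y.op_L2[OF Xu])
    have cong: "(\<integral>z. a z * c z \<partial>\<omega>) = (\<integral>z. b z * c z \<partial>\<omega>)"
      if "AE z in \<omega>. a z = b z" "a \<in> L2 \<omega>" "b \<in> L2 \<omega>" "c \<in> L2 \<omega>" for a b c
      using that by (intro integral_cong_AE) (auto simp: L2_def)
    have v_Suc: "AE z in \<omega>. v (Suc n) z = kernel_op X (u n) z" for n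
      using op_P[OF v[of n]] by (simp add: v_def u_def)
    then have u_Suc: "AE z in \<omega>. u (Suc n) z = kernel_op Y (kernel_op X (u n)) z" for n
      unfolding u_def[of] using v Xu[unfolded u_def]
      by (intro Y.op_cong_AE) (auto simp: L2_def u_def)
    have Y_u: "AE z in \<omega>. kernel_op Y (u n) z = u n z" for n
      unfolding u_def using v Y.op_idempotent by (auto simp: L2_def)
    \<comment> \<open>Against a function in the range of \<open>Y\<close>, a factor \<open>Y\<close> can be dropped.\<close>
    have Y_drop: "(\<integral>z. kernel_op Y a z * u n z \<partial>\<omega>) = (\<integral>z. a z * u n z \<partial>\<omega>)" if "a \<in> L2 \<omega>" for a n
      using Y.op_self_adjoint[OF that u[of n]] cong[OF Y_u[of n] Y.op_L2[OF u] u that]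
      by (simp add: mult.commute)
    have shift: "(\<integral>z. u (Suc m) z * b z \<partial>\<omega>) = (\<integral>z. kernel_op Y (kernel_op X (u m)) z * b z \<partial>\<omega>)"
      if "b \<in> L2 \<omega>" for m b
      by (rule cong[OF u_Suc u YXu that])
    have half: "(\<integral>z. u (Suc m) z * u n z \<partial>\<omega>) = (\<integral>z. kernel_op X (u m) z * u n z \<partial>\<omega>)" for m n
      using shift[OF u] Y_drop[OF Xu] by simp
    have hankel: "(\<integral>z. u (Suc m) z * u n z \<partial>\<omega>) = (\<integral>z. u m z * u (Suc n) z \<partial>\<omega>)" for m n
      using half[of m n] half[of n m] X.op_self_adjoint[OF u[of m] u[of n]] by (simp add: mult.commute)
    obtain C where C: "\<forall>n>0. \<forall>f \<in> L2_0 \<omega>.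
        \<bar>\<integral>z. u 0 z * (kernel_op P ^^ n) f z \<partial>\<omega>\<bar> \<le> C * \<rho> ^ n * L2_norm \<omega> f"
      using decay u by blast
    have "(\<integral>z. (u 1 z)\<^sup>2 \<partial>\<omega>) \<le> \<rho>\<^sup>2 * (\<integral>z. (u 0 z)\<^sup>2 \<partial>\<omega>)"
    proof (rule hankel_first_step[where u = u and K = "C * L2_norm \<omega> g", OF u hankel])
      fix n :: nat
      assume n: "0 < n"
      have "(\<integral>z. u 0 z * u n z \<partial>\<omega>) = (\<integral>z. u 0 z * v n z \<partial>\<omega>)"
        using Y_drop[OF v, of n 0] by (simp add: u_def mult.commute)
      then show "\<bar>\<integral>z. u 0 z * u n z \<partial>\<omega>\<bar> \<le> C * L2_norm \<omega> g * \<rho> ^ n"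
        using C[rule_format, OF n g0] by (simp add: v_def mult_ac)
    qed
    then have "(L2_norm \<omega> (u 1))\<^sup>2 \<le> (\<rho> * L2_norm \<omega> (u 0))\<^sup>2"
      by (simp add: L2_norm_square power_mult_distrib)
    then have "L2_norm \<omega> (u 1) \<le> \<rho> * L2_norm \<omega> (u 0)"
      by (rule power2_le_imp_le) (simp add: \<rho>)
    then have "L2_norm \<omega> (u 0) * L2_norm \<omega> (u 1) \<le> L2_norm \<omega> (u 0) * (\<rho> * L2_norm \<omega> (u 0))"
      by (intro mult_left_mono) auto
    also have "\<dots> = \<rho> * (\<integral>z. (u 0 z)\<^sup>2 \<partial>\<omega>)"
      using L2_norm_square[of \<omega> "u 0"] by (simp add: power2_eq_square[of "L2_norm \<omega> (u 0)"])
    also have "\<dots> \<le> \<rho> * (\<integral>z. (g z)\<^sup>2 \<partial>\<omega>)"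
      using Y.op_contraction[OF g] \<rho> by (intro mult_left_mono) (simp_all add: u_def v_def)
    finally have bound: "L2_norm \<omega> (u 0) * L2_norm \<omega> (u 1) \<le> \<rho> * (\<integral>z. (g z)\<^sup>2 \<partial>\<omega>)" .
    have "(\<integral>z. (kernel_op P g z)\<^sup>2 \<partial>\<omega>) = (\<integral>z. (kernel_op X (u 0) z)\<^sup>2 \<partial>\<omega>)"
    proof (rule integral_cong_AE)
      show "AE z in \<omega>. (kernel_op P g z)\<^sup>2 = (kernel_op X (u 0) z)\<^sup>2"
        using op_P[OF g] by eventually_elim (simp add: u_def v_def)
    qed (use L2_measurable[OF P.op_L2[OF g]] L2_measurable[OF Xu[of 0]] in auto)
    also have "\<dots> = (\<integral>z. kernel_op X (u 0) z * kernel_op X (u 0) z \<partial>\<omega>)"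
      by (simp add: power2_eq_square)
    also have "\<dots> = (\<integral>z. kernel_op X (kernel_op X (u 0)) z * u 0 z \<partial>\<omega>)"
      using X.op_self_adjoint[OF Xu u] by simp
    also have "\<dots> = (\<integral>z. kernel_op X (u 0) z * u 0 z \<partial>\<omega>)"
      using X.op_idempotent[OF L2_measurable[OF u[of 0]]] by (intro Bochner_Integration.integral_cong) auto
    also have "\<dots> = (\<integral>z. u 0 z * u 1 z \<partial>\<omega>)"
      using half[of 0 0] by (simp add: mult.commute)
    also have "\<dots> \<le> L2_norm \<omega> (u 0) * L2_norm \<omega> (u 1)"
      using L2_inner_le_norms[OF u[of 0] u[of 1]] by simp
    finally show ?thesis
      using bound by simp
  qed
  then show ?thesis
    using \<rho> unfolding P_def by blast
qed

section \<open>Mixtures of kernels\<close>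

lemma nn_integral_add_measure:
  assumes sets: "sets N = sets M" and f: "f \<in> borel_measurable M"
  shows "(\<integral>\<^sup>+x. f x \<partial>add_measure M N) = (\<integral>\<^sup>+x. f x \<partial>M) + (\<integral>\<^sup>+x. f x \<partial>N)"
  using f
proof induction
  case (cong f g)
  then show ?case
    using sets_eq_imp_space_eq[OF sets] by (simp cong: nn_integral_cong_simp)
next
  case (set A)
  then show ?case
    using sets by (simp add: emeasure_add_measure)
next
  case (mult u c)
  then show ?case
    using sets by (simp add: nn_integral_cmult distrib_left cong: measurable_cong_sets)
next
  case (add u v)
  then show ?case
    using sets by (simp add: nn_integral_add add_ac cong: measurable_cong_sets)
next
  case (seq U)
  have U: "U i \<in> borel_measurable N" "U i \<in> borel_measurable (add_measure M N)" for i
    using seq sets by (simp_all cong: measurable_cong_sets)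
  have inc: "incseq (\<lambda>i. integral\<^sup>N M (U i))" "incseq (\<lambda>i. integral\<^sup>N N (U i))"
    using \<open>incseq U\<close> by (auto simp: incseq_def le_fun_def intro!: nn_integral_mono)
  show ?case
    unfolding SUP_apply
    using seq U inc by (simp add: nn_integral_monotone_convergence_SUP ennreal_SUP_add)
qed

lemma integral_add_measure:
  fixes f :: "'a \<Rightarrow> real"
  assumes sets: "sets N = sets M" and M: "integrable M f" and N: "integrable N f"
  shows "(\<integral>x. f x \<partial>add_measure M N) = (\<integral>x. f x \<partial>M) + (\<integral>x. f x \<partial>N)"
proof -
  have f: "f \<in> borel_measurable M"
    using M by auto
  have nn: "(\<integral>\<^sup>+x. ennreal (f x) \<partial>add_measure M N) = (\<integral>\<^sup>+x. ennreal (f x) \<partial>M) + (\<integral>\<^sup>+x. ennreal (f x) \<partial>N)"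
      "(\<integral>\<^sup>+x. ennreal (- f x) \<partial>add_measure M N) = (\<integral>\<^sup>+x. ennreal (- f x) \<partial>M) + (\<integral>\<^sup>+x. ennreal (- f x) \<partial>N)"
    using f by (auto intro!: nn_integral_add_measure[OF sets])
  have "integrable (add_measure M N) f"
    using M N nn f by (auto simp: real_integrable_def cong: measurable_cong_sets)
  then show ?thesis
    using M N by (simp add: real_lebesgue_integral_def nn real_integrable_def less_top enn2real_plus)
qed

lemma integral_scale_measure:
  fixes f :: "'a \<Rightarrow> real"
  assumes r: "0 \<le> r" and f: "integrable M f"
  shows "integrable (scale_measure (ennreal r) M) f"
    and "(\<integral>x. f x \<partial>scale_measure (ennreal r) M) = r * (\<integral>x. f x \<partial>M)"
proof -
  have fm: "f \<in> borel_measurable M"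
    using f by auto
  have nn: "(\<integral>\<^sup>+x. ennreal (f x) \<partial>scale_measure (ennreal r) M) = ennreal r * (\<integral>\<^sup>+x. ennreal (f x) \<partial>M)"
      "(\<integral>\<^sup>+x. ennreal (- f x) \<partial>scale_measure (ennreal r) M) = ennreal r * (\<integral>\<^sup>+x. ennreal (- f x) \<partial>M)"
    using fm by (auto intro!: nn_integral_scale_measure)
  show int: "integrable (scale_measure (ennreal r) M) f"
    using f nn fm by (auto simp: real_integrable_def ennreal_mult_eq_top_iff cong: measurable_cong_sets)
  show "(\<integral>x. f x \<partial>scale_measure (ennreal r) M) = r * (\<integral>x. f x \<partial>M)"
    using f int r by (simp add: real_lebesgue_integral_def nn enn2real_mult right_diff_distrib)
qed

definition mixture :: "real \<Rightarrow> ('a \<Rightarrow> 'b measure) \<Rightarrow> ('a \<Rightarrow> 'b measure) \<Rightarrow> 'a \<Rightarrow> 'b measure" where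
  "mixture r P Q = (\<lambda>z. add_measure (scale_measure (ennreal r) (P z)) (scale_measure (ennreal (1 - r)) (Q z)))"

lemma sets_mixture [simp]: "sets (mixture r P Q z) = sets (P z)"
  by (simp add: mixture_def)

lemma emeasure_mixture:
  assumes "sets (Q z) = sets (P z)" "A \<in> sets (P z)"
  shows "emeasure (mixture r P Q z) A = ennreal r * emeasure (P z) A + ennreal (1 - r) * emeasure (Q z) A"
  using assms by (simp add: mixture_def emeasure_add_measure)

lemma
  assumes "invariant_kernel \<omega> P" and "invariant_kernel \<omega> Q" and r: "0 \<le> r" "r \<le> 1"
  shows invariant_kernel_mixture: "invariant_kernel \<omega> (mixture r P Q)"
    and op_mixture: "f \<in> L2 \<omega> \<Longrightarrow>
      AE z in \<omega>. kernel_op (mixture r P Q) f z = r * kernel_op P f z + (1 - r) * kernel_op Q f z"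
proof -
  interpret P: invariant_kernel \<omega> P by fact
  interpret Q: invariant_kernel \<omega> Q by fact
  have em: "emeasure (mixture r P Q z) A = ennreal r * emeasure (P z) A + ennreal (1 - r) * emeasure (Q z) A"
    if "z \<in> space \<omega>" "A \<in> sets \<omega>" for z A
    using that by (intro emeasure_mixture) (simp_all add: P.sets_P Q.sets_P)
  have emP: "(\<lambda>z. emeasure (P z) A) \<in> borel_measurable \<omega>" "(\<lambda>z. emeasure (Q z) A) \<in> borel_measurable \<omega>"
    if "A \<in> sets \<omega>" for A
    using that P.subkernel Q.subkernel by (auto intro: measurable_emeasure_kernel)
  have prob: "prob_space (mixture r P Q z)" if z: "z \<in> space \<omega>" for z
  proof (rule prob_spaceI)
    interpret Pz: prob_space "P z" using z by (rule P.prob_space_P)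
    interpret Qz: prob_space "Q z" using z by (rule Q.prob_space_P)
    have "space (mixture r P Q z) = space \<omega>"
      using z by (intro sets_eq_imp_space_eq) (simp add: P.sets_P)
    then show "emeasure (mixture r P Q z) (space (mixture r P Q z)) = 1"
      using em[OF z sets.top] Pz.emeasure_space_1 Qz.emeasure_space_1 r
      by (simp add: P.space_P[OF z] Q.space_P[OF z] ennreal_plus[symmetric] del: ennreal_plus)
  qed
  have sub: "mixture r P Q \<in> \<omega> \<rightarrow>\<^sub>M subprob_algebra \<omega>"
  proof (rule measurable_subprob_algebra)
    show "subprob_space (mixture r P Q z)" if "z \<in> space \<omega>" for z
      using prob[OF that] by (rule prob_space_imp_subprob_space)
    show "sets (mixture r P Q z) = sets \<omega>" if "z \<in> space \<omega>" for z
      using that by (simp add: P.sets_P)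
    show "(\<lambda>z. emeasure (mixture r P Q z) A) \<in> borel_measurable \<omega>" if A: "A \<in> sets \<omega>" for A
      using emP[OF A] by (subst measurable_cong[OF em[OF _ A]]) auto
  qed
  show mix: "invariant_kernel \<omega> (mixture r P Q)"
  proof
    show "mixture r P Q \<in> \<omega> \<rightarrow>\<^sub>M prob_algebra \<omega>"
      by (rule measurable_prob_algebraI[OF prob sub])
    show "\<omega> \<bind> mixture r P Q = \<omega>"
    proof (rule measure_eqI)
      show sets: "sets (\<omega> \<bind> mixture r P Q) = sets \<omega>"
        by (rule sets_bind_measurable[OF sub P.not_empty])
      fix A
      assume "A \<in> sets (\<omega> \<bind> mixture r P Q)"
      then have A: "A \<in> sets \<omega>"
        using sets by simp
      have "emeasure (\<omega> \<bind> mixture r P Q) A = (\<integral>\<^sup>+z. emeasure (mixture r P Q z) A \<partial>\<omega>)"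
        by (rule emeasure_bind[OF P.not_empty sub A])
      also have "\<dots> = (\<integral>\<^sup>+z. ennreal r * emeasure (P z) A + ennreal (1 - r) * emeasure (Q z) A \<partial>\<omega>)"
        by (intro nn_integral_cong em A)
      also have "\<dots> = ennreal r * emeasure (\<omega> \<bind> P) A + ennreal (1 - r) * emeasure (\<omega> \<bind> Q) A"
        using emP[OF A] emeasure_bind[OF P.not_empty P.subkernel A] emeasure_bind[OF P.not_empty Q.subkernel A]
        by (simp add: nn_integral_add nn_integral_cmult)
      also have "\<dots> = emeasure \<omega> A"
        using r by (simp add: P.invariant Q.invariant distrib_right[symmetric] ennreal_plus[symmetric] del: ennreal_plus)
      finally show "emeasure (\<omega> \<bind> mixture r P Q) A = emeasure \<omega> A" .
    qed
  qed
  assume f: "f \<in> L2 \<omega>"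
  show "AE z in \<omega>. kernel_op (mixture r P Q) f z = r * kernel_op P f z + (1 - r) * kernel_op Q f z"
    using P.AE_square_integrable[OF f] Q.AE_square_integrable[OF f]
    by eventually_elim (use r in \<open>simp add: kernel_op_def mixture_def integral_add_measure integral_scale_measure P.sets_P Q.sets_P\<close>)
qed

lemma contraction_random_scan:
  assumes "averaging_kernel \<omega> X" and "averaging_kernel \<omega> Y" and r: "0 \<le> r" "r \<le> 1"
    and rate: "L2_rate \<omega> (mixture r X Y) < 1"
  shows "\<exists>\<kappa><1. \<forall>f \<in> L2_0 \<omega>.
    (\<integral>z. (kernel_op (mixture r X Y) f z)\<^sup>2 \<partial>\<omega>) \<le> \<kappa> * (\<integral>z. (f z)\<^sup>2 \<partial>\<omega>)"
proof -
  interpret X: averaging_kernel \<omega> X by fact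
  interpret Y: averaging_kernel \<omega> Y by fact
  interpret mix: invariant_kernel \<omega> "mixture r X Y"
    by (rule invariant_kernel_mixture[OF X.invariant_kernel_axioms Y.invariant_kernel_axioms r])
  have inner: "(\<integral>z. kernel_op (mixture r X Y) f z * g z \<partial>\<omega>) =
      r * (\<integral>z. kernel_op X f z * g z \<partial>\<omega>) + (1 - r) * (\<integral>z. kernel_op Y f z * g z \<partial>\<omega>)"
    if f: "f \<in> L2 \<omega>" and g: "g \<in> L2 \<omega>" for f g
  proof -
    have "(\<integral>z. kernel_op (mixture r X Y) f z * g z \<partial>\<omega>) =
        (\<integral>z. r * (kernel_op X f z * g z) + (1 - r) * (kernel_op Y f z * g z) \<partial>\<omega>)"
    proof (rule integral_cong_AE)
      show "AE z in \<omega>. kernel_op (mixture r X Y) f z * g z =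
          r * (kernel_op X f z * g z) + (1 - r) * (kernel_op Y f z * g z)"
        using op_mixture[OF X.invariant_kernel_axioms Y.invariant_kernel_axioms r f]
        by eventually_elim (simp add: distrib_right mult.assoc)
    qed (use L2_measurable[OF mix.op_L2[OF f]] L2_measurable[OF X.op_L2[OF f]]
        L2_measurable[OF Y.op_L2[OF f]] L2_measurable[OF g] in auto)
    also have "\<dots> = r * (\<integral>z. kernel_op X f z * g z \<partial>\<omega>) + (1 - r) * (\<integral>z. kernel_op Y f z * g z \<partial>\<omega>)"
      using L2_mult_integrable[OF X.op_L2[OF f] g] L2_mult_integrable[OF Y.op_L2[OF f] g] by simp
    finally show ?thesis .
  qed
  show ?thesis
  proof (rule mix.contraction_if_self_adjoint[OF rate])
    fix f g
    assume f: "f \<in> L2 \<omega>" and g: "g \<in> L2 \<omega>"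
    show "(\<integral>z. kernel_op (mixture r X Y) f z * g z \<partial>\<omega>) = (\<integral>z. f z * kernel_op (mixture r X Y) g z \<partial>\<omega>)"
      using inner[OF f g] inner[OF g f] X.op_self_adjoint[OF f g] Y.op_self_adjoint[OF f g]
      by (simp add: mult.commute)
  qed
qed

section \<open>Replacing one Gibbs step by a minorized kernel\<close>

context
  fixes \<omega> :: "'a measure" and X Y H :: "'a \<Rightarrow> 'a measure" and c :: real
  assumes X: "averaging_kernel \<omega> X" and Y: "averaging_kernel \<omega> Y" and H: "invariant_kernel \<omega> H"
    and c: "0 < c"
    and minor: "\<And>z A. z \<in> space \<omega> \<Longrightarrow> A \<in> sets \<omega> \<Longrightarrow> ennreal c * emeasure (Y z) A \<le> emeasure (H z) A"
begin

interpretation X: averaging_kernel \<omega> X by (rule X)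
interpretation Y: averaging_kernel \<omega> Y by (rule Y)
interpretation H: invariant_kernel \<omega> H by (rule H)

lemma rate_alternating_minorized:
  assumes rate: "L2_rate \<omega> (\<lambda>z. X z \<bind> Y) < 1"
  shows "L2_rate \<omega> (\<lambda>z. X z \<bind> H) < 1"
proof -
  obtain \<kappa> where \<kappa>: "\<kappa> < 1" and le: "\<And>f. f \<in> L2_0 \<omega> \<Longrightarrow>
      (\<integral>z. (kernel_op (\<lambda>z. X z \<bind> Y) f z)\<^sup>2 \<partial>\<omega>) \<le> \<kappa> * (\<integral>z. (f z)\<^sup>2 \<partial>\<omega>)"
    using contraction_alternating[OF X Y rate] by blast
  show ?thesis
  proof (rule rate_less_one_if_minorized[OF _ _ c _ \<kappa> le])
    show "invariant_kernel \<omega> (\<lambda>z. X z \<bind> H)" "invariant_kernel \<omega> (\<lambda>z. X z \<bind> Y)"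
      by (rule X.invariant_kernel_bind[OF H] X.invariant_kernel_bind[OF Y.invariant_kernel_axioms])+
    fix z A
    assume z: "z \<in> space \<omega>" and A: "A \<in> sets \<omega>"
    have Xz: "X z \<in> space (prob_algebra \<omega>)"
      using X.prob_space_P[OF z] X.sets_P[OF z] by (simp add: space_prob_algebra)
    have "(\<lambda>w. emeasure (Y w) A) \<in> borel_measurable (X z)"
      using measurable_emeasure_kernel[OF Y.subkernel A] by (simp add: X.measurable_P[OF z])
    then have "ennreal c * emeasure (X z \<bind> Y) A = (\<integral>\<^sup>+w. ennreal c * emeasure (Y w) A \<partial>X z)"
      by (simp add: emeasure_bind_prob_algebra[OF Xz Y.kernel A] nn_integral_cmult)
    also have "\<dots> \<le> (\<integral>\<^sup>+w. emeasure (H w) A \<partial>X z)"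
      using X.space_P[OF z] minor A by (intro nn_integral_mono) simp
    also have "\<dots> = emeasure (X z \<bind> H) A"
      by (simp add: emeasure_bind_prob_algebra[OF Xz H.kernel A])
    finally show "ennreal c * emeasure (X z \<bind> Y) A \<le> emeasure (X z \<bind> H) A" .
  qed
qed

lemma rate_random_scan_minorized:
  assumes r: "0 < r" "r < 1" and s: "0 < s" "s < 1" and rate: "L2_rate \<omega> (mixture r Y X) < 1"
  shows "L2_rate \<omega> (mixture s H X) < 1"
proof -
  have r': "0 \<le> r" "r \<le> 1" and s': "0 \<le> s" "s \<le> 1"
    using r s by auto
  obtain \<kappa> where \<kappa>: "\<kappa> < 1" and le: "\<And>f. f \<in> L2_0 \<omega> \<Longrightarrow>
      (\<integral>z. (kernel_op (mixture r Y X) f z)\<^sup>2 \<partial>\<omega>) \<le> \<kappa> * (\<integral>z. (f z)\<^sup>2 \<partial>\<omega>)"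
    using contraction_random_scan[OF Y X r' rate] by blast
  \<comment> \<open>The largest factor \<open>d\<close> for which \<open>H \<ge> c Y\<close> covers \<open>d\<close> times the Gibbs mixture component by component.\<close>
  define d where "d = min (s * c / r) ((1 - s) / (1 - r))"
  have d: "0 < d"
    using r s c by (simp add: d_def)
  have "d \<le> s * c / r" "d \<le> (1 - s) / (1 - r)"
    by (simp_all add: d_def)
  then have d1: "d * r \<le> s * c" and d2: "d * (1 - r) \<le> 1 - s"
    using r by (simp_all add: pos_le_divide_eq)
  show ?thesis
  proof (rule rate_less_one_if_minorized[OF _ _ d _ \<kappa> le])
    show "invariant_kernel \<omega> (mixture s H X)" "invariant_kernel \<omega> (mixture r Y X)"
      by (rule invariant_kernel_mixture[OF H X.invariant_kernel_axioms s']
        invariant_kernel_mixture[OF Y.invariant_kernel_axioms X.invariant_kernel_axioms r'])+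
    fix z A
    assume z: "z \<in> space \<omega>" and A: "A \<in> sets \<omega>"
    have sets: "sets (X z) = sets (Y z)" "sets (X z) = sets (H z)" "A \<in> sets (Y z)" "A \<in> sets (H z)"
      using z A by (simp_all add: X.sets_P Y.sets_P H.sets_P)
    have "ennreal d * emeasure (mixture r Y X z) A =
        ennreal (d * r) * emeasure (Y z) A + ennreal (d * (1 - r)) * emeasure (X z) A"
      using d r by (simp add: emeasure_mixture sets distrib_left ennreal_mult mult.assoc)
    also have "\<dots> \<le> ennreal (s * c) * emeasure (Y z) A + ennreal (1 - s) * emeasure (X z) A"
      using d1 d2 by (intro add_mono mult_right_mono ennreal_leI) auto
    also have "\<dots> = ennreal s * (ennreal c * emeasure (Y z) A) + ennreal (1 - s) * emeasure (X z) A"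
      using c s by (simp add: ennreal_mult mult.assoc)
    also have "\<dots> \<le> ennreal s * emeasure (H z) A + ennreal (1 - s) * emeasure (X z) A"
      using minor[OF z A] by (intro add_mono mult_left_mono) auto
    also have "\<dots> = emeasure (mixture s H X z) A"
      using sets by (intro emeasure_mixture[symmetric]) auto
    finally show "ennreal d * emeasure (mixture r Y X z) A \<le> emeasure (mixture s H X z) A" .
  qed
qed

end

text \<open>
  The samplers and their factorizations into single updates agree on the product space, but need not
  agree at arguments outside of it.
\<close>

lemma (in invariant_kernel) L2_rate_cong:
  assumes eq: "\<And>z. z \<in> space \<omega> \<Longrightarrow> Q z = P z"
  shows "L2_rate \<omega> Q = L2_rate \<omega> P"
proof -
  have pow: "z \<in> space \<omega> \<Longrightarrow> kernel_pow \<omega> Q n z = kernel_pow \<omega> P n z" for n z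
  proof (induction n arbitrary: z)
    case (Suc n)
    then show ?case
      using space_P[OF Suc.prems] by (auto simp: eq intro!: bind_cong)
  qed simp
  have "\<mu> \<bind> kernel_pow \<omega> Q n = \<mu> \<bind> kernel_pow \<omega> P n" if "\<mu> \<in> L2_star \<omega>" for \<mu> n
    using that by (intro bind_cong pow) (auto simp: L2_star_def dest: sets_eq_imp_space_eq)
  then show ?thesis
    unfolding L2_rate_def by (intro arg_cong[where f = Inf]) auto
qed

section \<open>The Gibbs updates\<close>

lemma prob_algebra_cong: "sets M = sets N \<Longrightarrow> prob_algebra M = prob_algebra N"
  using subprob_algebra_cong[of M N] by (simp add: prob_algebra_def)

lemma pair_measure_return_right:
  assumes R: "prob_space R" "sets R = sets MX" and y: "y \<in> space MY"
  shows "R \<Otimes>\<^sub>M return MY y = distr R (MX \<Otimes>\<^sub>M MY) (\<lambda>x. (x, y))"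
proof (rule pair_measure_eqI)
  show "sigma_finite_measure R" "sigma_finite_measure (return MY y)"
    using R prob_space_return[OF y] by (auto intro: prob_space_imp_sigma_finite)
  show "sets (R \<Otimes>\<^sub>M return MY y) = sets (distr R (MX \<Otimes>\<^sub>M MY) (\<lambda>x. (x, y)))"
    using R by (simp cong: sets_pair_measure_cong)
  fix A B
  assume A: "A \<in> sets R" and B: "B \<in> sets (return MY y)"
  have meas: "(\<lambda>x. (x, y)) \<in> R \<rightarrow>\<^sub>M MX \<Otimes>\<^sub>M MY"
    using R y by (simp add: measurable_Pair measurable_ident_sets)
  have "(\<lambda>x. (x, y)) -` (A \<times> B) \<inter> space R = (if y \<in> B then A else {})"
    using sets.sets_into_space[OF A] by auto
  then show "emeasure R A * emeasure (return MY y) B =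
      emeasure (distr R (MX \<Otimes>\<^sub>M MY) (\<lambda>x. (x, y))) (A \<times> B)"
    using A B R by (simp add: emeasure_distr[OF meas])
qed

lemma pair_measure_return_left:
  assumes R: "prob_space R" "sets R = sets MY" and x: "x \<in> space MX"
  shows "return MX x \<Otimes>\<^sub>M R = distr R (MX \<Otimes>\<^sub>M MY) (\<lambda>y. (x, y))"
proof (rule pair_measure_eqI)
  show "sigma_finite_measure R" "sigma_finite_measure (return MX x)"
    using R prob_space_return[OF x] by (auto intro: prob_space_imp_sigma_finite)
  show "sets (return MX x \<Otimes>\<^sub>M R) = sets (distr R (MX \<Otimes>\<^sub>M MY) (\<lambda>y. (x, y)))"
    using R by (simp cong: sets_pair_measure_cong)
  fix A B
  assume A: "A \<in> sets (return MX x)" and B: "B \<in> sets R"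
  have meas: "(\<lambda>y. (x, y)) \<in> R \<rightarrow>\<^sub>M MX \<Otimes>\<^sub>M MY"
    using R x by (simp add: measurable_Pair measurable_ident_sets)
  have "(\<lambda>y. (x, y)) -` (A \<times> B) \<inter> space R = (if x \<in> A then B else {})"
    using sets.sets_into_space[OF B] by auto
  then show "emeasure (return MX x) A * emeasure R B =
      emeasure (distr R (MX \<Otimes>\<^sub>M MY) (\<lambda>y. (x, y))) (A \<times> B)"
    using A B R by (simp add: emeasure_distr[OF meas])
qed

lemma measure_eqI_rectangles:
  assumes M: "sets M = sets (MX \<Otimes>\<^sub>M MY)" and N: "sets N = sets (MX \<Otimes>\<^sub>M MY)" and "finite_measure M"
    and eq: "\<And>A B. A \<in> sets MX \<Longrightarrow> B \<in> sets MY \<Longrightarrow> emeasure M (A \<times> B) = emeasure N (A \<times> B)"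
  shows "M = N"
proof (rule measure_eqI_generator_eq[OF Int_stable_pair_measure_generator[of MX MY]])
  interpret M: finite_measure M by fact
  show "{A \<times> B |A B. A \<in> sets MX \<and> B \<in> sets MY} \<subseteq> Pow (space MX \<times> space MY)"
    by (rule pair_measure_closed)
  show "sets M = sigma_sets (space MX \<times> space MY) {A \<times> B |A B. A \<in> sets MX \<and> B \<in> sets MY}"
    "sets N = sigma_sets (space MX \<times> space MY) {A \<times> B |A B. A \<in> sets MX \<and> B \<in> sets MY}"
    by (simp_all add: M N sets_pair_measure)
  show "range (\<lambda>_::nat. space MX \<times> space MY) \<subseteq> {A \<times> B |A B. A \<in> sets MX \<and> B \<in> sets MY}"
    by auto
  show "(\<Union>i::nat. space MX \<times> space MY) = space MX \<times> space MY"
    by simp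
  show "emeasure M (space MX \<times> space MY) \<noteq> \<infinity>" for i :: nat
    by simp
  show "emeasure M S = emeasure N S" if "S \<in> {A \<times> B |A B. A \<in> sets MX \<and> B \<in> sets MY}" for S
    using that eq by auto
qed

locale two_component = prob_space PI
  for PI :: "('a \<times> 'b) measure" +
  fixes MX :: "'a measure" and MY :: "'b measure" and KXY :: "'b \<Rightarrow> 'a measure" and KYX :: "'a \<Rightarrow> 'b measure"
  assumes sets_PI: "sets PI = sets (MX \<Otimes>\<^sub>M MY)"
    and cond_fst: "cond_fst_given_snd MX MY PI KXY"
    and cond_snd: "cond_snd_given_fst MX MY PI KYX"
begin

definition update_fst :: "('a \<Rightarrow> 'b \<Rightarrow> 'a measure) \<Rightarrow> 'a \<times> 'b \<Rightarrow> ('a \<times> 'b) measure" where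
  "update_fst R = (\<lambda>(x, y). R x y \<Otimes>\<^sub>M return MY y)"

definition update_snd :: "('a \<Rightarrow> 'b measure) \<Rightarrow> 'a \<times> 'b \<Rightarrow> ('a \<times> 'b) measure" where
  "update_snd K = (\<lambda>(x, y). return MX x \<Otimes>\<^sub>M K x)"

lemma space_PI: "space PI = space MX \<times> space MY"
  using sets_eq_imp_space_eq[OF sets_PI] by (simp add: space_pair_measure)

lemma measurable_PI: "measurable PI N = measurable (MX \<Otimes>\<^sub>M MY) N"
  by (rule measurable_cong_sets[OF sets_PI refl])

lemma KXY: "KXY \<in> MY \<rightarrow>\<^sub>M prob_algebra MX"
  using cond_fst by (simp add: cond_fst_given_snd_def)

lemma KYX: "KYX \<in> MX \<rightarrow>\<^sub>M prob_algebra MY"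
  using cond_snd by (simp add: cond_snd_given_fst_def)

lemma KXY_snd: "(\<lambda>(x, y). KXY y) \<in> MX \<Otimes>\<^sub>M MY \<rightarrow>\<^sub>M prob_algebra MX"
  unfolding case_prod_beta by (rule measurable_compose[OF measurable_snd KXY])

lemma KXY_D: "y \<in> space MY \<Longrightarrow> prob_space (KXY y) \<and> sets (KXY y) = sets MX"
  using measurable_space[OF KXY] by (simp add: space_prob_algebra)

lemma KYX_D: "x \<in> space MX \<Longrightarrow> prob_space (KYX x) \<and> sets (KYX x) = sets MY"
  using measurable_space[OF KYX] by (simp add: space_prob_algebra)

lemma update_fst_eq_distr:
  assumes R: "(\<lambda>(x, y). R x y) \<in> MX \<Otimes>\<^sub>M MY \<rightarrow>\<^sub>M prob_algebra MX" and "x \<in> space MX" "y \<in> space MY"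
  shows "update_fst R (x, y) = distr (R x y) (MX \<Otimes>\<^sub>M MY) (\<lambda>x'. (x', y))"
    and "(\<lambda>x'. (x', y)) \<in> R x y \<rightarrow>\<^sub>M MX \<Otimes>\<^sub>M MY"
proof -
  have "prob_space (R x y)" "sets (R x y) = sets MX"
    using measurable_space[OF R, of "(x, y)"] assms by (simp_all add: space_prob_algebra space_pair_measure)
  then show "update_fst R (x, y) = distr (R x y) (MX \<Otimes>\<^sub>M MY) (\<lambda>x'. (x', y))"
    "(\<lambda>x'. (x', y)) \<in> R x y \<rightarrow>\<^sub>M MX \<Otimes>\<^sub>M MY"
    using pair_measure_return_right[of "R x y" MX y MY] assms
    by (simp_all add: update_fst_def measurable_Pair measurable_ident_sets)
qed

lemma update_snd_eq_distr:
  assumes "x \<in> space MX" "y \<in> space MY"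
  shows "update_snd KYX (x, y) = distr (KYX x) (MX \<Otimes>\<^sub>M MY) (\<lambda>y'. (x, y'))"
    and "(\<lambda>y'. (x, y')) \<in> KYX x \<rightarrow>\<^sub>M MX \<Otimes>\<^sub>M MY"
proof -
  have "prob_space (KYX x)" "sets (KYX x) = sets MY"
    using KYX_D[OF assms(1)] by simp_all
  then show "update_snd KYX (x, y) = distr (KYX x) (MX \<Otimes>\<^sub>M MY) (\<lambda>y'. (x, y'))"
    "(\<lambda>y'. (x, y')) \<in> KYX x \<rightarrow>\<^sub>M MX \<Otimes>\<^sub>M MY"
    using pair_measure_return_left[of "KYX x" MY x MX] assms
    by (simp_all add: update_snd_def measurable_Pair measurable_ident_sets)
qed

lemma update_fst_kernel:
  assumes R: "(\<lambda>(x, y). R x y) \<in> MX \<Otimes>\<^sub>M MY \<rightarrow>\<^sub>M prob_algebra MX"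
  shows "update_fst R \<in> PI \<rightarrow>\<^sub>M prob_algebra PI"
proof -
  have "(\<lambda>z. R (fst z) (snd z) \<Otimes>\<^sub>M return MY (snd z)) \<in> MX \<Otimes>\<^sub>M MY \<rightarrow>\<^sub>M prob_algebra (MX \<Otimes>\<^sub>M MY)"
  proof (rule measurable_pair_prob)
    show "(\<lambda>z. R (fst z) (snd z)) \<in> MX \<Otimes>\<^sub>M MY \<rightarrow>\<^sub>M prob_algebra MX"
      using R by (simp add: case_prod_beta)
    show "(\<lambda>z. return MY (snd z)) \<in> MX \<Otimes>\<^sub>M MY \<rightarrow>\<^sub>M prob_algebra MY"
      by (rule measurable_compose[OF measurable_snd measurable_return_prob_space])
  qed
  moreover have "update_fst R = (\<lambda>z. R (fst z) (snd z) \<Otimes>\<^sub>M return MY (snd z))"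
    by (simp add: update_fst_def fun_eq_iff)
  ultimately show ?thesis
    by (simp only: prob_algebra_cong[OF sets_PI] measurable_PI)
qed

lemma update_snd_kernel: "update_snd KYX \<in> PI \<rightarrow>\<^sub>M prob_algebra PI"
proof -
  have "(\<lambda>z. return MX (fst z) \<Otimes>\<^sub>M KYX (fst z)) \<in> MX \<Otimes>\<^sub>M MY \<rightarrow>\<^sub>M prob_algebra (MX \<Otimes>\<^sub>M MY)"
  proof (rule measurable_pair_prob)
    show "(\<lambda>z. return MX (fst z)) \<in> MX \<Otimes>\<^sub>M MY \<rightarrow>\<^sub>M prob_algebra MX"
      by (rule measurable_compose[OF measurable_fst measurable_return_prob_space])
    show "(\<lambda>z. KYX (fst z)) \<in> MX \<Otimes>\<^sub>M MY \<rightarrow>\<^sub>M prob_algebra MY"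
      by (rule measurable_compose[OF measurable_fst KYX])
  qed
  moreover have "update_snd KYX = (\<lambda>z. return MX (fst z) \<Otimes>\<^sub>M KYX (fst z))"
    by (simp add: update_snd_def fun_eq_iff)
  ultimately show ?thesis
    by (simp only: prob_algebra_cong[OF sets_PI] measurable_PI)
qed

lemma emeasure_update_fst:
  assumes R: "(\<lambda>(x, y). R x y) \<in> MX \<Otimes>\<^sub>M MY \<rightarrow>\<^sub>M prob_algebra MX" and z: "z \<in> space PI"
    and A: "A \<in> sets MX" and B: "B \<in> sets MY"
  shows "emeasure (update_fst R z) (A \<times> B) = emeasure (R (fst z) (snd z)) A * indicator B (snd z)"
proof -
  obtain x y where [simp]: "z = (x, y)" and xy: "x \<in> space MX" "y \<in> space MY"
    using z by (auto simp: space_PI)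
  have "sets (R x y) = sets MX"
    using measurable_space[OF R, of "(x, y)"] xy by (simp add: space_prob_algebra space_pair_measure)
  then have "(\<lambda>x'. (x', y)) -` (A \<times> B) \<inter> space (R x y) = (if y \<in> B then A else {})"
    using sets.sets_into_space[OF A] sets_eq_imp_space_eq[of "R x y" MX] by auto
  then show ?thesis
    using A B by (simp add: update_fst_eq_distr[OF R xy] emeasure_distr indicator_def)
qed

lemma emeasure_update_snd:
  assumes z: "z \<in> space PI" and A: "A \<in> sets MX" and B: "B \<in> sets MY"
  shows "emeasure (update_snd KYX z) (A \<times> B) = emeasure (KYX (fst z)) B * indicator A (fst z)"
proof -
  obtain x y where [simp]: "z = (x, y)" and xy: "x \<in> space MX" "y \<in> space MY"
    using z by (auto simp: space_PI)
  have "(\<lambda>y'. (x, y')) -` (A \<times> B) \<inter> space (KYX x) = (if x \<in> A then B else {})"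
    using sets.sets_into_space[OF B] sets_eq_imp_space_eq[of "KYX x" MY] KYX_D[OF xy(1)] by auto
  then show ?thesis
    using A B by (simp add: update_snd_eq_distr[OF xy] emeasure_distr indicator_def)
qed

lemma invariant_if_rectangles:
  assumes P: "P \<in> PI \<rightarrow>\<^sub>M prob_algebra PI"
    and eq: "\<And>A B. A \<in> sets MX \<Longrightarrow> B \<in> sets MY \<Longrightarrow> (\<integral>\<^sup>+z. emeasure (P z) (A \<times> B) \<partial>PI) = emeasure PI (A \<times> B)"
  shows "invariant_kernel PI P"
proof
  note sub = measurable_prob_algebraD[OF P]
  show "PI \<bind> P = PI"
  proof (rule measure_eqI_rectangles[where MX = MX and MY = MY])
    show "sets (PI \<bind> P) = sets (MX \<Otimes>\<^sub>M MY)"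
      using sets_bind_measurable[OF sub not_empty] sets_PI by simp
    have "prob_space (PI \<bind> P)"
      by (rule prob_space_bind'[OF _ P]) (simp add: space_prob_algebra prob_space_axioms)
    then show "finite_measure (PI \<bind> P)"
      by (simp add: prob_space_def)
    show "emeasure (PI \<bind> P) (A \<times> B) = emeasure PI (A \<times> B)" if "A \<in> sets MX" "B \<in> sets MY" for A B
      using that eq[OF that] by (subst emeasure_bind[OF not_empty sub]) (auto simp: sets_PI)
  qed (rule sets_PI)
qed (rule P)

lemma invariant_Gibbs_fst: "invariant_kernel PI (update_fst (\<lambda>_. KXY))"
proof (rule invariant_if_rectangles[OF update_fst_kernel[OF KXY_snd]])
  fix A B
  assume A: "A \<in> sets MX" and B: "B \<in> sets MY"
  have meas: "(\<lambda>y. emeasure (KXY y) A * indicator B y) \<in> borel_measurable MY"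
    using measurable_emeasure_kernel[OF measurable_prob_algebraD[OF KXY] A] B by measurable
  have "(\<integral>\<^sup>+z. emeasure (update_fst (\<lambda>_. KXY) z) (A \<times> B) \<partial>PI) =
      (\<integral>\<^sup>+z. emeasure (KXY (snd z)) A * indicator B (snd z) \<partial>PI)"
    using emeasure_update_fst[OF KXY_snd _ A B] by (intro nn_integral_cong) auto
  also have "\<dots> = (\<integral>\<^sup>+y. emeasure (KXY y) A * indicator B y \<partial>marginal_snd MY PI)"
    unfolding marginal_snd_def using meas by (subst nn_integral_distr) (auto simp: measurable_PI)
  also have "\<dots> = emeasure PI (A \<times> B)"
    using cond_fst A B by (simp add: cond_fst_given_snd_def)
  finally show "(\<integral>\<^sup>+z. emeasure (update_fst (\<lambda>_. KXY) z) (A \<times> B) \<partial>PI) = emeasure PI (A \<times> B)" .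
qed

lemma invariant_Gibbs_snd: "invariant_kernel PI (update_snd KYX)"
proof (rule invariant_if_rectangles[OF update_snd_kernel])
  fix A B
  assume A: "A \<in> sets MX" and B: "B \<in> sets MY"
  have meas: "(\<lambda>x. emeasure (KYX x) B * indicator A x) \<in> borel_measurable MX"
    using measurable_emeasure_kernel[OF measurable_prob_algebraD[OF KYX] B] A by measurable
  have "(\<integral>\<^sup>+z. emeasure (update_snd KYX z) (A \<times> B) \<partial>PI) =
      (\<integral>\<^sup>+z. emeasure (KYX (fst z)) B * indicator A (fst z) \<partial>PI)"
    using emeasure_update_snd[OF _ A B] by (intro nn_integral_cong) auto
  also have "\<dots> = (\<integral>\<^sup>+x. emeasure (KYX x) B * indicator A x \<partial>marginal_fst MX PI)"
    unfolding marginal_fst_def using meas by (subst nn_integral_distr) (auto simp: measurable_PI)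
  also have "\<dots> = emeasure PI (A \<times> B)"
    using cond_snd A B by (simp add: cond_snd_given_fst_def)
  finally show "(\<integral>\<^sup>+z. emeasure (update_snd KYX z) (A \<times> B) \<partial>PI) = emeasure PI (A \<times> B)" .
qed

text \<open>
  Updating the first component leaves the second one unchanged, so the kernel and hence \<open>kernel_op f\<close>
  are constant along the update.
\<close>

lemma averaging_Gibbs_fst: "averaging_kernel PI (update_fst (\<lambda>_. KXY))"
proof -
  interpret G: invariant_kernel PI "update_fst (\<lambda>_. KXY)"
    by (rule invariant_Gibbs_fst)
  show ?thesis
  proof
    fix f g :: "'a \<times> 'b \<Rightarrow> real" and z
    assume f: "f \<in> borel_measurable PI" and g: "g \<in> borel_measurable PI" and z: "z \<in> space PI"
    obtain x y where [simp]: "z = (x, y)" and xy: "x \<in> space MX" "y \<in> space MY"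
      using z by (auto simp: space_PI)
    have op: "kernel_op (update_fst (\<lambda>_. KXY)) h (x, y) = (\<integral>x'. h (x', y) \<partial>KXY y)"
      if "h \<in> borel_measurable PI" for h
      using that update_fst_eq_distr[OF KXY_snd xy]
      by (simp add: kernel_op_def measurable_PI integral_distr)
    define k where "k = kernel_op (update_fst (\<lambda>_. KXY)) f (x, y)"
    have const: "kernel_op (update_fst (\<lambda>_. KXY)) f (x', y) = k" for x'
      by (simp add: k_def kernel_op_def update_fst_def)
    have "(\<lambda>w. kernel_op (update_fst (\<lambda>_. KXY)) f w * g w) \<in> borel_measurable PI"
      by (intro borel_measurable_times G.op_measurable f g)
    then have "kernel_op (update_fst (\<lambda>_. KXY)) (\<lambda>w. kernel_op (update_fst (\<lambda>_. KXY)) f w * g w) z =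
        (\<integral>x'. kernel_op (update_fst (\<lambda>_. KXY)) f (x', y) * g (x', y) \<partial>KXY y)"
      by (simp add: op)
    also have "\<dots> = k * kernel_op (update_fst (\<lambda>_. KXY)) g z"
      by (simp add: const op[OF g])
    finally show "kernel_op (update_fst (\<lambda>_. KXY)) (\<lambda>w. kernel_op (update_fst (\<lambda>_. KXY)) f w * g w) z =
        kernel_op (update_fst (\<lambda>_. KXY)) f z * kernel_op (update_fst (\<lambda>_. KXY)) g z"
      by (simp add: k_def)
  qed
qed

lemma averaging_Gibbs_snd: "averaging_kernel PI (update_snd KYX)"
proof -
  interpret G: invariant_kernel PI "update_snd KYX"
    by (rule invariant_Gibbs_snd)
  show ?thesis
  proof
    fix f g :: "'a \<times> 'b \<Rightarrow> real" and z
    assume f: "f \<in> borel_measurable PI" and g: "g \<in> borel_measurable PI" and z: "z \<in> space PI"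
    obtain x y where [simp]: "z = (x, y)" and xy: "x \<in> space MX" "y \<in> space MY"
      using z by (auto simp: space_PI)
    have op: "kernel_op (update_snd KYX) h (x, y) = (\<integral>y'. h (x, y') \<partial>KYX x)"
      if "h \<in> borel_measurable PI" for h
      using that update_snd_eq_distr[OF xy]
      by (simp add: kernel_op_def measurable_PI integral_distr)
    define k where "k = kernel_op (update_snd KYX) f (x, y)"
    have const: "kernel_op (update_snd KYX) f (x, y') = k" for y'
      by (simp add: k_def kernel_op_def update_snd_def)
    have "(\<lambda>w. kernel_op (update_snd KYX) f w * g w) \<in> borel_measurable PI"
      by (intro borel_measurable_times G.op_measurable f g)
    then have "kernel_op (update_snd KYX) (\<lambda>w. kernel_op (update_snd KYX) f w * g w) z =
        (\<integral>y'. kernel_op (update_snd KYX) f (x, y') * g (x, y') \<partial>KYX x)"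
      by (simp add: op)
    also have "\<dots> = k * kernel_op (update_snd KYX) g z"
      by (simp add: const op[OF g])
    finally show "kernel_op (update_snd KYX) (\<lambda>w. kernel_op (update_snd KYX) f w * g w) z =
        kernel_op (update_snd KYX) f z * kernel_op (update_snd KYX) g z"
      by (simp add: k_def)
  qed
qed

text \<open>
  If \<open>R\<close> preserves the conditional distribution of the first component, then an exact Gibbs update
  followed by an update with \<open>R\<close> has the same law as the Gibbs update alone. As \<open>PI\<close> is invariant under
  the Gibbs update, it is invariant under \<open>R\<close>.
\<close>

lemma invariant_update_fst:
  assumes R: "(\<lambda>(x, y). R x y) \<in> MX \<Otimes>\<^sub>M MY \<rightarrow>\<^sub>M prob_algebra MX"
    and inv: "\<And>y A. y \<in> space MY \<Longrightarrow> A \<in> sets MX \<Longrightarrow> (\<integral>\<^sup>+x. emeasure (R x y) A \<partial>KXY y) = emeasure (KXY y) A"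
  shows "invariant_kernel PI (update_fst R)"
proof (rule invariant_if_rectangles[OF update_fst_kernel[OF R]])
  interpret G: invariant_kernel PI "update_fst (\<lambda>_. KXY)"
    by (rule invariant_Gibbs_fst)
  fix A B
  assume A: "A \<in> sets MX" and B: "B \<in> sets MY"
  let ?F = "\<lambda>z. emeasure (update_fst R z) (A \<times> B)"
  have F: "?F \<in> borel_measurable PI"
    using A B by (intro measurable_emeasure_kernel[OF measurable_prob_algebraD[OF update_fst_kernel[OF R]]])
      (simp add: sets_PI)
  have inner: "(\<integral>\<^sup>+w. ?F w \<partial>update_fst (\<lambda>_. KXY) z) = emeasure (update_fst (\<lambda>_. KXY) z) (A \<times> B)"
    if z: "z \<in> space PI" for z
  proof -
    obtain x y where [simp]: "z = (x, y)" and xy: "x \<in> space MX" "y \<in> space MY"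
      using z by (auto simp: space_PI)
    have sp: "space (KXY y) = space MX"
      using KXY_D[OF xy(2)] sets_eq_imp_space_eq[of "KXY y" MX] by simp
    have Ry: "(\<lambda>x'. emeasure (R x' y) A) \<in> borel_measurable (KXY y)"
    proof -
      have "(\<lambda>x'. (\<lambda>(x, y). R x y) (x', y)) \<in> KXY y \<rightarrow>\<^sub>M prob_algebra MX"
        by (rule measurable_compose[OF update_fst_eq_distr(2)[OF KXY_snd xy] R])
      then show ?thesis
        using measurable_emeasure_kernel[OF measurable_prob_algebraD A] by simp
    qed
    have "(\<integral>\<^sup>+w. ?F w \<partial>update_fst (\<lambda>_. KXY) z) = (\<integral>\<^sup>+x'. ?F (x', y) \<partial>KXY y)"
      using F update_fst_eq_distr[OF KXY_snd xy] by (simp add: nn_integral_distr measurable_PI)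
    also have "\<dots> = (\<integral>\<^sup>+x'. emeasure (R x' y) A * indicator B y \<partial>KXY y)"
      using xy sp by (intro nn_integral_cong) (simp add: emeasure_update_fst[OF R _ A B] space_PI)
    also have "\<dots> = emeasure (KXY y) A * indicator B y"
      using inv[OF xy(2) A] Ry by (simp add: nn_integral_multc)
    also have "\<dots> = emeasure (update_fst (\<lambda>_. KXY) z) (A \<times> B)"
      by (simp add: emeasure_update_fst[OF KXY_snd z A B, simplified])
    finally show ?thesis .
  qed
  have "(\<integral>\<^sup>+z. ?F z \<partial>PI) = (\<integral>\<^sup>+z. \<integral>\<^sup>+w. ?F w \<partial>update_fst (\<lambda>_. KXY) z \<partial>PI)"
    by (rule G.nn_integral_kernel[OF F, symmetric])
  also have "\<dots> = (\<integral>\<^sup>+z. emeasure (update_fst (\<lambda>_. KXY) z) (A \<times> B) \<partial>PI)"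
    by (rule nn_integral_cong[OF inner])
  also have "\<dots> = emeasure (PI \<bind> update_fst (\<lambda>_. KXY)) (A \<times> B)"
    using A B by (intro emeasure_bind[OF not_empty G.subkernel, symmetric]) (simp add: sets_PI)
  finally show "(\<integral>\<^sup>+z. ?F z \<partial>PI) = emeasure PI (A \<times> B)"
    by (simp add: G.invariant)
qed

lemma update_fst_mono:
  assumes R: "(\<lambda>(x, y). R x y) \<in> MX \<Otimes>\<^sub>M MY \<rightarrow>\<^sub>M prob_algebra MX"
    and S: "(\<lambda>(x, y). S x y) \<in> MX \<Otimes>\<^sub>M MY \<rightarrow>\<^sub>M prob_algebra MX"
    and le: "\<And>x y A. x \<in> space MX \<Longrightarrow> y \<in> space MY \<Longrightarrow> A \<in> sets MX \<Longrightarrow>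
      c * emeasure (R x y) A \<le> emeasure (S x y) A"
    and z: "z \<in> space PI" and A: "A \<in> sets PI"
  shows "c * emeasure (update_fst R z) A \<le> emeasure (update_fst S z) A"
proof -
  obtain x y where [simp]: "z = (x, y)" and xy: "x \<in> space MX" "y \<in> space MY"
    using z by (auto simp: space_PI)
  have A': "A \<in> sets (MX \<Otimes>\<^sub>M MY)"
    using A by (simp add: sets_PI)
  have sp: "space (R x y) = space MX" "space (S x y) = space MX"
    using measurable_space[OF R, of "(x, y)"] measurable_space[OF S, of "(x, y)"] xy
    by (auto simp: space_prob_algebra space_pair_measure dest: sets_eq_imp_space_eq)
  have "(\<lambda>x'. (x', y)) \<in> MX \<rightarrow>\<^sub>M MX \<Otimes>\<^sub>M MY"
    using xy by simp
  then have "(\<lambda>x'. (x', y)) -` A \<inter> space MX \<in> sets MX"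
    using A' by (rule measurable_sets)
  then show ?thesis
    using le[OF xy] by (simp add: update_fst_eq_distr[OF R xy] update_fst_eq_distr[OF S xy] emeasure_distr A' sp)
qed

lemma update_snd_bind:
  assumes Q: "Q \<in> PI \<rightarrow>\<^sub>M prob_algebra PI" and x: "x \<in> space MX" and y: "y \<in> space MY"
  shows "update_snd KYX (x, y) \<bind> Q = KYX x \<bind> (\<lambda>y'. Q (x, y'))"
proof -
  have "Q \<in> MX \<Otimes>\<^sub>M MY \<rightarrow>\<^sub>M subprob_algebra PI"
    using measurable_prob_algebraD[OF Q] by (simp add: measurable_PI)
  then show ?thesis
    using KYX_D[OF x] unfolding update_snd_eq_distr(1)[OF x y]
    by (intro bind_distr[OF update_snd_eq_distr(2)[OF x y]]) (auto simp: prob_space.not_empty)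
qed

end

section \<open>The Metropolis-Hastings kernel\<close>

locale metropolis_hastings = sigma_finite_measure MX
  for MX :: "'a measure" +
  fixes MY :: "'b measure" and pXY :: "'a \<Rightarrow> 'b \<Rightarrow> real" and q :: "'a \<Rightarrow> 'a \<Rightarrow> 'b \<Rightarrow> real"
  assumes pXY_measurable: "(\<lambda>(x, y). pXY x y) \<in> borel_measurable (MX \<Otimes>\<^sub>M MY)"
    and pXY_nonneg: "\<And>x y. x \<in> space MX \<Longrightarrow> y \<in> space MY \<Longrightarrow> 0 \<le> pXY x y"
    and q_measurable: "(\<lambda>(x', x, y). q x' x y) \<in> borel_measurable (MX \<Otimes>\<^sub>M MX \<Otimes>\<^sub>M MY)"
    and q_nonneg: "\<And>x' x y. x' \<in> space MX \<Longrightarrow> x \<in> space MX \<Longrightarrow> y \<in> space MY \<Longrightarrow> 0 \<le> q x' x y"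
    and q_density: "\<And>x y. x \<in> space MX \<Longrightarrow> y \<in> space MY \<Longrightarrow> (\<integral>\<^sup>+x'. ennreal (q x' x y) \<partial>MX) = 1"
begin

text \<open>
  The density of the accepted proposals, and the probability of accepting one.
\<close>

definition move :: "'a \<Rightarrow> 'a \<Rightarrow> 'b \<Rightarrow> real" where
  "move x' x y = q x' x y * MH_accept pXY q x' x y"

definition move_mass :: "'a \<Rightarrow> 'b \<Rightarrow> ennreal" where
  "move_mass x y = (\<integral>\<^sup>+x'. ennreal (move x' x y) \<partial>MX)"

lemma pXY_compose:
  assumes "f \<in> N \<rightarrow>\<^sub>M MX" "g \<in> N \<rightarrow>\<^sub>M MY"
  shows "(\<lambda>w. pXY (f w) (g w)) \<in> borel_measurable N"
  using measurable_compose[OF measurable_Pair[OF assms] pXY_measurable] by simp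

lemma q_compose:
  assumes "f \<in> N \<rightarrow>\<^sub>M MX" "g \<in> N \<rightarrow>\<^sub>M MX" "h \<in> N \<rightarrow>\<^sub>M MY"
  shows "(\<lambda>w. q (f w) (g w) (h w)) \<in> borel_measurable N"
  using measurable_compose[OF measurable_Pair[OF assms(1) measurable_Pair[OF assms(2,3)]] q_measurable] by simp

lemma move_compose:
  assumes f: "f \<in> N \<rightarrow>\<^sub>M MX" and g: "g \<in> N \<rightarrow>\<^sub>M MX" and h: "h \<in> N \<rightarrow>\<^sub>M MY"
  shows "(\<lambda>w. move (f w) (g w) (h w)) \<in> borel_measurable N"
proof -
  note [measurable] = pXY_compose[OF f h] pXY_compose[OF g h] q_compose[OF f g h] q_compose[OF g f h]
  show ?thesis
    unfolding move_def MH_accept_def by measurable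
qed

context
  fixes x x' y
  assumes x: "x \<in> space MX" and x': "x' \<in> space MX" and y: "y \<in> space MY"
begin

lemma accept_bounds: "0 \<le> MH_accept pXY q x' x y" "MH_accept pXY q x' x y \<le> 1"
  using x x' y by (auto simp: MH_accept_def pXY_nonneg q_nonneg)

lemma move_bounds: "0 \<le> move x' x y" "move x' x y \<le> q x' x y"
  using accept_bounds q_nonneg[OF x' x y] by (auto simp: move_def mult_left_le)

end

text \<open>
  The usual formula for the flow of accepted proposals. It also holds where a density vanishes: if the
  first term of the minimum is zero, then so are both sides. Its symmetry in \<open>x\<close> and \<open>x'\<close> is detailed balance.
\<close>

lemma pXY_move_eq_min:
  assumes "x \<in> space MX" "x' \<in> space MX" "y \<in> space MY"
  shows "pXY x y * move x' x y = min (pXY x y * q x' x y) (pXY x' y * q x x' y)"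
proof (cases "pXY x y * q x' x y = 0")
  case True
  then show ?thesis
    using assms by (auto simp: move_def MH_accept_def pXY_nonneg q_nonneg min_def)
next
  case False
  moreover have "0 \<le> pXY x y * q x' x y"
    using assms by (simp add: pXY_nonneg q_nonneg)
  ultimately have pos: "0 < pXY x y * q x' x y"
    by linarith
  have "pXY x y * move x' x y = (pXY x y * q x' x y) * min 1 ((pXY x' y * q x x' y) / (pXY x y * q x' x y))"
    using False by (simp add: move_def MH_accept_def)
  also have "\<dots> = min (pXY x y * q x' x y) (pXY x' y * q x x' y)"
  proof -
    have "a * min 1 (b / a) = min a b" if "0 < a" for a b :: real
      using that by (auto simp: min_def field_simps)
    then show ?thesis
      using pos by blast
  qed
  finally show ?thesis .
qed

lemma detailed_balance:
  assumes "x \<in> space MX" "x' \<in> space MX" "y \<in> space MY"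
  shows "pXY x y * move x' x y = pXY x' y * move x x' y"
  using assms by (simp add: pXY_move_eq_min min.commute)

text \<open>
  Both terms of the minimum above are at least \<open>c\<close> times \<open>pXY x y * pXY x' y\<close>: one by the bound on the
  proposal from \<open>x\<close> to \<open>x'\<close>, the other by the bound on the reverse proposal.
\<close>

lemma move_minorized:
  assumes c: "0 \<le> c" and le: "\<And>x' x. x' \<in> space MX \<Longrightarrow> x \<in> space MX \<Longrightarrow> c * pXY x' y \<le> q x' x y"
    and x: "x \<in> space MX" and x': "x' \<in> space MX" and y: "y \<in> space MY"
  shows "c * pXY x' y \<le> move x' x y"
proof (cases "pXY x y * q x' x y = 0")
  case True
  then show ?thesis
    using le[OF x' x] by (simp add: move_def MH_accept_def)
next
  case False
  then have "pXY x y \<noteq> 0"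
    by simp
  then have p: "0 < pXY x y"
    using pXY_nonneg[OF x y] by simp
  have "pXY x y * (c * pXY x' y) \<le> min (pXY x y * q x' x y) (pXY x' y * q x x' y)"
  proof (rule min.boundedI)
    show "pXY x y * (c * pXY x' y) \<le> pXY x y * q x' x y"
      using p le[OF x' x] by simp
    show "pXY x y * (c * pXY x' y) \<le> pXY x' y * q x x' y"
      using mult_left_mono[OF le[OF x x'] pXY_nonneg[OF x' y]] by (simp add: mult_ac)
  qed
  then have "pXY x y * (c * pXY x' y) \<le> pXY x y * move x' x y"
    by (simp add: pXY_move_eq_min[OF x x' y])
  then show ?thesis
    using p by simp
qed

lemma move_mass_le_1:
  assumes "x \<in> space MX" "y \<in> space MY"
  shows "move_mass x y \<le> 1"
proof -
  have "move_mass x y \<le> (\<integral>\<^sup>+x'. ennreal (q x' x y) \<partial>MX)"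
    unfolding move_mass_def using assms by (intro nn_integral_mono ennreal_leI move_bounds)
  then show ?thesis
    using q_density[OF assms] by simp
qed

lemma rejection_probability:
  assumes x: "x \<in> space MX" and y: "y \<in> space MY"
  shows "ennreal (1 - (\<integral>z. move z x y \<partial>MX)) = 1 - move_mass x y"
proof -
  have "(\<lambda>z. move z x y) \<in> borel_measurable MX"
    using x y by (intro move_compose) auto
  then have "(\<integral>z. move z x y \<partial>MX) = enn2real (move_mass x y)"
    unfolding move_mass_def using move_bounds(1)[OF x _ y] by (intro integral_eq_nn_integral) auto
  moreover have "ennreal (enn2real (move_mass x y)) = move_mass x y"
    using le_less_trans[OF move_mass_le_1[OF x y] ennreal_one_less_top] by simp
  ultimately show ?thesis
    using ennreal_minus[of "enn2real (move_mass x y)" 1] by simp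
qed

lemma sets_P_MH [simp]: "sets (P_MH MX pXY q x y) = sets MX"
  by (simp add: P_MH_def)

lemma space_P_MH [simp]: "space (P_MH MX pXY q x y) = space MX"
  by (rule sets_eq_imp_space_eq) simp

lemma emeasure_P_MH:
  assumes x: "x \<in> space MX" and y: "y \<in> space MY" and A: "A \<in> sets MX"
  shows "emeasure (P_MH MX pXY q x y) A =
    (\<integral>\<^sup>+x'. ennreal (move x' x y) * indicator A x' \<partial>MX) + (1 - move_mass x y) * indicator A x"
proof -
  have "(\<lambda>z. move z x y) \<in> borel_measurable MX"
    using x y by (intro move_compose) auto
  then show ?thesis
    using A unfolding P_MH_def move_def[symmetric] rejection_probability[OF x y]
    by (simp add: emeasure_add_measure emeasure_density)
qed

lemma P_MH_prob_space:
  assumes x: "x \<in> space MX" and y: "y \<in> space MY"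
  shows "prob_space (P_MH MX pXY q x y)"
proof (rule prob_spaceI)
  have "(\<integral>\<^sup>+x'. ennreal (move x' x y) * indicator (space MX) x' \<partial>MX) = move_mass x y"
    unfolding move_mass_def by (intro nn_integral_cong) simp
  then show "emeasure (P_MH MX pXY q x y) (space (P_MH MX pXY q x y)) = 1"
    using x move_mass_le_1[OF x y] by (simp add: emeasure_P_MH[OF x y])
qed

lemma move_mass_measurable: "(\<lambda>z. move_mass (fst z) (snd z)) \<in> borel_measurable (MX \<Otimes>\<^sub>M MY)"
  unfolding move_mass_def
proof (rule borel_measurable_nn_integral)
  have "(\<lambda>w. move (snd w) (fst (fst w)) (snd (fst w))) \<in> borel_measurable ((MX \<Otimes>\<^sub>M MY) \<Otimes>\<^sub>M MX)"
    by (rule move_compose) measurable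
  then show "(\<lambda>(z, x'). ennreal (move x' (fst z) (snd z))) \<in> borel_measurable ((MX \<Otimes>\<^sub>M MY) \<Otimes>\<^sub>M MX)"
    by (simp add: case_prod_beta)
qed

lemma P_MH_kernel: "(\<lambda>(x, y). P_MH MX pXY q x y) \<in> MX \<Otimes>\<^sub>M MY \<rightarrow>\<^sub>M prob_algebra MX"
proof (rule measurable_prob_algebraI)
  show prob: "prob_space (case z of (x, y) \<Rightarrow> P_MH MX pXY q x y)" if "z \<in> space (MX \<Otimes>\<^sub>M MY)" for z
    using that by (auto simp: space_pair_measure P_MH_prob_space)
  show "(\<lambda>(x, y). P_MH MX pXY q x y) \<in> MX \<Otimes>\<^sub>M MY \<rightarrow>\<^sub>M subprob_algebra MX"
  proof (rule measurable_subprob_algebra)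
    show "subprob_space (case z of (x, y) \<Rightarrow> P_MH MX pXY q x y)" if "z \<in> space (MX \<Otimes>\<^sub>M MY)" for z
      using prob[OF that] by (rule prob_space_imp_subprob_space)
    show "sets (case z of (x, y) \<Rightarrow> P_MH MX pXY q x y) = sets MX" for z
      by (simp split: prod.split)
    fix A
    assume A: "A \<in> sets MX"
    have eq: "emeasure (case z of (x, y) \<Rightarrow> P_MH MX pXY q x y) A =
        (\<integral>\<^sup>+x'. ennreal (move x' (fst z) (snd z)) * indicator A x' \<partial>MX) +
        (1 - move_mass (fst z) (snd z)) * indicator A (fst z)"
      if "z \<in> space (MX \<Otimes>\<^sub>M MY)" for z
      using that A by (auto simp: space_pair_measure emeasure_P_MH)
    have "(\<lambda>z. \<integral>\<^sup>+x'. ennreal (move x' (fst z) (snd z)) * indicator A x' \<partial>MX) \<in> borel_measurable (MX \<Otimes>\<^sub>M MY)"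
    proof (rule borel_measurable_nn_integral)
      have [measurable]: "(\<lambda>w. move (snd w) (fst (fst w)) (snd (fst w))) \<in> borel_measurable ((MX \<Otimes>\<^sub>M MY) \<Otimes>\<^sub>M MX)"
        by (rule move_compose) measurable
      show "(\<lambda>(z, x'). ennreal (move x' (fst z) (snd z)) * indicator A x') \<in> borel_measurable ((MX \<Otimes>\<^sub>M MY) \<Otimes>\<^sub>M MX)"
        unfolding case_prod_beta using A by measurable
    qed
    moreover have "(\<lambda>z. (1 - move_mass (fst z) (snd z)) * indicator A (fst z)) \<in> borel_measurable (MX \<Otimes>\<^sub>M MY)"
      using move_mass_measurable A by measurable
    ultimately have "(\<lambda>z. (\<integral>\<^sup>+x'. ennreal (move x' (fst z) (snd z)) * indicator A x' \<partial>MX) +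
        (1 - move_mass (fst z) (snd z)) * indicator A (fst z)) \<in> borel_measurable (MX \<Otimes>\<^sub>M MY)"
      by (rule borel_measurable_add)
    then show "(\<lambda>z. emeasure (case z of (x, y) \<Rightarrow> P_MH MX pXY q x y) A) \<in> borel_measurable (MX \<Otimes>\<^sub>M MY)"
      by (subst measurable_cong[OF eq])
  qed
qed

text \<open>
  By detailed balance, the mass that accepted proposals bring into \<open>A\<close> equals the mass that they take
  out of points of \<open>A\<close>; the rejected remainder stays in place.
\<close>

lemma P_MH_invariant:
  assumes y: "y \<in> space MY" and A: "A \<in> sets MX"
  shows "(\<integral>\<^sup>+x. emeasure (P_MH MX pXY q x y) A \<partial>density MX (\<lambda>x. ennreal (pXY x y))) =
    emeasure (density MX (\<lambda>x. ennreal (pXY x y))) A"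
proof -
  interpret pair: pair_sigma_finite MX MX ..
  let ?p = "\<lambda>x. ennreal (pXY x y)" and ?m = "\<lambda>x' x. ennreal (move x' x y)"
  have p [measurable]: "(\<lambda>x. pXY x y) \<in> borel_measurable MX"
    using y by (intro pXY_compose) auto
  have m [measurable]: "(\<lambda>w. move (fst w) (snd w) y) \<in> borel_measurable (MX \<Otimes>\<^sub>M MX)"
      "(\<lambda>w. move (snd w) (fst w) y) \<in> borel_measurable (MX \<Otimes>\<^sub>M MX)"
    using y by (auto intro!: move_compose)
  have m_fst: "(\<lambda>x'. move x' x y) \<in> borel_measurable MX" if "x \<in> space MX" for x
    using y that by (intro move_compose) auto
  have mass [measurable]: "(\<lambda>x. move_mass x y) \<in> borel_measurable MX"
    using measurable_compose[OF measurable_Pair[OF measurable_ident measurable_const[OF y]] move_mass_measurable]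
    by simp
  note A [measurable]
  have balance: "?p x * ?m x' x = ?p x' * ?m x x'" if "x \<in> space MX" "x' \<in> space MX" for x x'
    using that y detailed_balance[OF that y] by (simp add: ennreal_mult[symmetric] pXY_nonneg move_bounds)
  have "(\<integral>\<^sup>+x. ?p x * (\<integral>\<^sup>+x'. ?m x' x * indicator A x' \<partial>MX) \<partial>MX) =
      (\<integral>\<^sup>+x. \<integral>\<^sup>+x'. ?p x * (?m x' x * indicator A x') \<partial>MX \<partial>MX)"
    using m_fst by (intro nn_integral_cong nn_integral_cmult[symmetric]) auto
  also have "\<dots> = (\<integral>\<^sup>+x'. \<integral>\<^sup>+x. ?p x * (?m x' x * indicator A x') \<partial>MX \<partial>MX)"
    by (intro pair.Fubini') (simp add: case_prod_beta)
  also have "\<dots> = (\<integral>\<^sup>+x'. \<integral>\<^sup>+x. (?p x' * indicator A x') * ?m x x' \<partial>MX \<partial>MX)"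
    using balance by (intro nn_integral_cong) (simp add: mult_ac indicator_def)
  also have "\<dots> = (\<integral>\<^sup>+x. ?p x * (move_mass x y * indicator A x) \<partial>MX)"
    unfolding move_mass_def using m_fst
    by (intro nn_integral_cong) (simp add: nn_integral_cmult mult_ac)
  finally have flow: "(\<integral>\<^sup>+x. ?p x * (\<integral>\<^sup>+x'. ?m x' x * indicator A x' \<partial>MX) \<partial>MX) =
      (\<integral>\<^sup>+x. ?p x * (move_mass x y * indicator A x) \<partial>MX)" .
  have inner [measurable]: "(\<lambda>x. \<integral>\<^sup>+x'. ?m x' x * indicator A x' \<partial>MX) \<in> borel_measurable MX"
    by (rule borel_measurable_nn_integral) (simp add: case_prod_beta)
  have meas: "(\<lambda>x. emeasure (P_MH MX pXY q x y) A) \<in> borel_measurable MX"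
    by (subst measurable_cong[OF emeasure_P_MH[OF _ y A]]) auto
  have "(\<integral>\<^sup>+x. emeasure (P_MH MX pXY q x y) A \<partial>density MX ?p) =
      (\<integral>\<^sup>+x. ?p x * emeasure (P_MH MX pXY q x y) A \<partial>MX)"
    using meas by (intro nn_integral_density) auto
  also have "\<dots> = (\<integral>\<^sup>+x. ?p x * (\<integral>\<^sup>+x'. ?m x' x * indicator A x' \<partial>MX) +
      ?p x * ((1 - move_mass x y) * indicator A x) \<partial>MX)"
    by (intro nn_integral_cong) (simp add: emeasure_P_MH[OF _ y A] distrib_left)
  also have "\<dots> = (\<integral>\<^sup>+x. ?p x * (\<integral>\<^sup>+x'. ?m x' x * indicator A x' \<partial>MX) \<partial>MX) +
      (\<integral>\<^sup>+x. ?p x * ((1 - move_mass x y) * indicator A x) \<partial>MX)"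
    by (rule nn_integral_add) auto
  also have "\<dots> = (\<integral>\<^sup>+x. ?p x * (move_mass x y * indicator A x) \<partial>MX) +
      (\<integral>\<^sup>+x. ?p x * ((1 - move_mass x y) * indicator A x) \<partial>MX)"
    by (simp only: flow)
  also have "\<dots> = (\<integral>\<^sup>+x. ?p x * (move_mass x y * indicator A x) +
      ?p x * ((1 - move_mass x y) * indicator A x) \<partial>MX)"
    by (rule nn_integral_add[symmetric]) auto
  also have "\<dots> = (\<integral>\<^sup>+x. ?p x * indicator A x \<partial>MX)"
  proof (intro nn_integral_cong)
    fix x
    assume "x \<in> space MX"
    then have one: "move_mass x y + (1 - move_mass x y) = 1"
      using move_mass_le_1[OF _ y] by simp
    show "?p x * (move_mass x y * indicator A x) + ?p x * ((1 - move_mass x y) * indicator A x) =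
        ?p x * indicator A x"
      by (simp only: distrib_left[symmetric] distrib_right[symmetric] one mult_1)
  qed
  also have "\<dots> = emeasure (density MX ?p) A"
    using A by (simp add: emeasure_density)
  finally show ?thesis .
qed

lemma P_MH_minorized:
  assumes c: "0 \<le> c" and le: "\<And>x' x. x' \<in> space MX \<Longrightarrow> x \<in> space MX \<Longrightarrow> c * pXY x' y \<le> q x' x y"
    and x: "x \<in> space MX" and y: "y \<in> space MY" and A: "A \<in> sets MX"
  shows "ennreal c * emeasure (density MX (\<lambda>x. ennreal (pXY x y))) A \<le> emeasure (P_MH MX pXY q x y) A"
proof -
  have p [measurable]: "(\<lambda>x. pXY x y) \<in> borel_measurable MX"
    using y by (intro pXY_compose) auto
  note A [measurable]
  have "ennreal c * emeasure (density MX (\<lambda>x. ennreal (pXY x y))) A =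
      (\<integral>\<^sup>+x'. ennreal c * (ennreal (pXY x' y) * indicator A x') \<partial>MX)"
    by (simp add: emeasure_density nn_integral_cmult)
  also have "\<dots> \<le> (\<integral>\<^sup>+x'. ennreal (move x' x y) * indicator A x' \<partial>MX)"
  proof (intro nn_integral_mono)
    fix x'
    assume x': "x' \<in> space MX"
    have "ennreal c * ennreal (pXY x' y) \<le> ennreal (move x' x y)"
      using move_minorized[OF c le x x' y] c pXY_nonneg[OF x' y]
      by (simp add: ennreal_mult[symmetric] ennreal_leI)
    then show "ennreal c * (ennreal (pXY x' y) * indicator A x') \<le> ennreal (move x' x y) * indicator A x'"
      by (simp add: indicator_def)
  qed
  also have "\<dots> \<le> emeasure (P_MH MX pXY q x y) A"
    by (simp add: emeasure_P_MH[OF x y A])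
  finally show ?thesis .
qed

end

lemma ratio_sup_minorization:
  assumes fin: "ratio_sup MX MY pXY q < \<infinity>"
    and q: "\<And>x' x y. x' \<in> space MX \<Longrightarrow> x \<in> space MX \<Longrightarrow> y \<in> space MY \<Longrightarrow> 0 \<le> q x' x y"
    and p: "\<And>x y. x \<in> space MX \<Longrightarrow> y \<in> space MY \<Longrightarrow> 0 \<le> pXY x y"
  shows "\<exists>c>0. \<forall>x' \<in> space MX. \<forall>x \<in> space MX. \<forall>y \<in> space MY. c * pXY x' y \<le> q x' x y"
proof -
  obtain C where C: "0 \<le> C" "ratio_sup MX MY pXY q = ennreal C"
    using fin by (cases "ratio_sup MX MY pXY q") auto
  \<comment> \<open>The summand 1 keeps the constant positive.\<close>
  have "1 / (C + 1) * pXY x' y \<le> q x' x y"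
    if "x' \<in> space MX" "x \<in> space MX" "y \<in> space MY" for x' x y
  proof -
    have "ennreal (pXY x' y) / ennreal (q x' x y) \<le> ratio_sup MX MY pXY q"
      unfolding ratio_sup_def using that by (intro SUP_upper2[of "(x', x, y)"]) auto
    then have ratio: "ennreal (pXY x' y) / ennreal (q x' x y) \<le> ennreal C"
      by (simp add: C)
    have "pXY x' y \<le> C * q x' x y"
    proof (cases "q x' x y = 0")
      case True
      have "pXY x' y = 0"
      proof (rule ccontr)
        assume "pXY x' y \<noteq> 0"
        then have "0 < pXY x' y"
          using p[OF that(1,3)] by simp
        then show False
          using ratio True by (simp add: ennreal_divide_zero top_unique)
      qed
      then show ?thesis
        using True by simp
    next
      case False
      then have "0 < q x' x y"
        using q[OF that] by simp
      then show ?thesis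
        using ratio p[OF that(1,3)] C by (simp add: divide_ennreal pos_divide_le_eq)
    qed
    also have "\<dots> \<le> (C + 1) * q x' x y"
      using q[OF that] by (intro mult_right_mono) auto
    finally show ?thesis
      using C by (simp add: field_simps)
  qed
  moreover have "0 < 1 / (C + 1)"
    using C by simp
  ultimately show ?thesis
    by blast
qed

section \<open>The hybrid samplers\<close>

theorem proposition5p2:
  fixes MX :: "'a measure" and MY :: "'b measure" and PI :: "('a \<times> 'b) measure"
    and KXY :: "'b \<Rightarrow> 'a measure" and KYX :: "'a \<Rightarrow> 'b measure"
    and pXY :: "'a \<Rightarrow> 'b \<Rightarrow> real" and pYX :: "'b \<Rightarrow> 'a \<Rightarrow> real"
    and q :: "'a \<Rightarrow> 'a \<Rightarrow> 'b \<Rightarrow> real"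
  assumes "sigma_finite_measure MX" and "sigma_finite_measure MY"
    and "prob_space PI" and "sets PI = sets (MX \<Otimes>\<^sub>M MY)"
    and "cond_fst_given_snd MX MY PI KXY"
    and "cond_snd_given_fst MX MY PI KYX"
    and "(\<lambda>(x, y). pXY x y) \<in> borel_measurable (MX \<Otimes>\<^sub>M MY)"
    and "\<forall>x \<in> space MX. \<forall>y \<in> space MY. 0 \<le> pXY x y"
    and "\<forall>y \<in> space MY. KXY y = density MX (\<lambda>x. ennreal (pXY x y))"
    and "\<forall>x \<in> space MX. (\<lambda>y. pYX y x) \<in> borel_measurable MY"
    and "\<forall>x \<in> space MX. \<forall>y \<in> space MY. 0 \<le> pYX y x"
    and "\<forall>x \<in> space MX. KYX x = density MY (\<lambda>y. ennreal (pYX y x))"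
    and "\<exists>A1 \<in> sets MX. \<exists>A2 \<in> sets MX. A1 \<inter> A2 = {} \<and>
           0 < emeasure (marginal_fst MX PI) A1 \<and> 0 < emeasure (marginal_fst MX PI) A2"
    and "\<exists>B1 \<in> sets MY. \<exists>B2 \<in> sets MY. B1 \<inter> B2 = {} \<and>
           0 < emeasure (marginal_snd MY PI) B1 \<and> 0 < emeasure (marginal_snd MY PI) B2"
    and "(\<lambda>(x', x, y). q x' x y) \<in> borel_measurable (MX \<Otimes>\<^sub>M MX \<Otimes>\<^sub>M MY)"
    and "\<forall>x' \<in> space MX. \<forall>x \<in> space MX. \<forall>y \<in> space MY. 0 \<le> q x' x y"
    and "\<forall>x \<in> space MX. \<forall>y \<in> space MY. (\<integral>\<^sup>+ x'. ennreal (q x' x y) \<partial>MX) = 1"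
    and "ratio_sup MX MY pXY q < \<infinity>"
  shows "(L2_rate PI (P_DG MY KXY KYX) < 1 \<longrightarrow> L2_rate PI (P_DC MX MY pXY q KYX) < 1) \<and>
         (\<forall>r \<in> {0<..<1}. \<forall>s \<in> {0<..<1}.
            L2_rate PI (P_RG MX MY KXY KYX r) < 1 \<longrightarrow> L2_rate PI (P_RC MX MY pXY q KYX s) < 1)"
proof -
  interpret two_component PI MX MY KXY KYX
    by (intro two_component.intro two_component_axioms.intro assms)
  interpret MH: metropolis_hastings MX MY pXY q
    using assms by (intro metropolis_hastings.intro metropolis_hastings_axioms.intro) auto
  let ?X = "update_snd KYX" and ?Y = "update_fst (\<lambda>_. KXY)" and ?H = "update_fst (P_MH MX pXY q)"
  have X: "averaging_kernel PI ?X" and Y: "averaging_kernel PI ?Y"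
    by (rule averaging_Gibbs_snd averaging_Gibbs_fst)+
  interpret X: averaging_kernel PI ?X by (rule X)
  interpret Y: averaging_kernel PI ?Y by (rule Y)
  have KXY_density: "y \<in> space MY \<Longrightarrow> KXY y = density MX (\<lambda>x. ennreal (pXY x y))" for y
    using assms by blast
  have H: "invariant_kernel PI ?H"
    by (rule invariant_update_fst[OF MH.P_MH_kernel]) (simp add: KXY_density MH.P_MH_invariant)
  interpret H: invariant_kernel PI ?H by (rule H)
  obtain c where c: "0 < c" and ratio: "\<And>x' x y. x' \<in> space MX \<Longrightarrow> x \<in> space MX \<Longrightarrow> y \<in> space MY \<Longrightarrow>
      c * pXY x' y \<le> q x' x y"
    using ratio_sup_minorization[OF assms(18) MH.q_nonneg MH.pXY_nonneg] by blast
  have minor: "ennreal c * emeasure (?Y z) A \<le> emeasure (?H z) A" if "z \<in> space PI" "A \<in> sets PI" for z A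
  proof (rule update_fst_mono[OF KXY_snd MH.P_MH_kernel _ that])
    fix x y A
    assume "x \<in> space MX" "y \<in> space MY" "A \<in> sets MX"
    then show "ennreal c * emeasure (KXY y) A \<le> emeasure (P_MH MX pXY q x y) A"
      using c ratio by (auto simp: KXY_density intro!: MH.P_MH_minorized)
  qed
  have DG: "L2_rate PI (P_DG MY KXY KYX) = L2_rate PI (\<lambda>z. ?X z \<bind> ?Y)"
  proof (rule invariant_kernel.L2_rate_cong[OF X.invariant_kernel_bind[OF Y.invariant_kernel_axioms]])
    fix z
    assume "z \<in> space PI"
    then show "P_DG MY KXY KYX z = ?X z \<bind> ?Y"
      by (auto simp: space_PI update_snd_bind[OF Y.kernel] P_DG_def) (simp add: update_fst_def)
  qed
  have DC: "L2_rate PI (P_DC MX MY pXY q KYX) = L2_rate PI (\<lambda>z. ?X z \<bind> ?H)"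
  proof (rule invariant_kernel.L2_rate_cong[OF X.invariant_kernel_bind[OF H]])
    fix z
    assume "z \<in> space PI"
    then show "P_DC MX MY pXY q KYX z = ?X z \<bind> ?H"
      by (auto simp: space_PI update_snd_bind[OF H.kernel] P_DC_def) (simp add: update_fst_def)
  qed
  have RG: "P_RG MX MY KXY KYX r = mixture r ?Y ?X" for r
    by (simp add: fun_eq_iff P_RG_def mixture_def update_fst_def update_snd_def)
  have RC: "P_RC MX MY pXY q KYX s = mixture s ?H ?X" for s
    by (simp add: fun_eq_iff P_RC_def mixture_def update_fst_def update_snd_def)
  show ?thesis
  proof (intro conjI ballI impI)
    assume "L2_rate PI (P_DG MY KXY KYX) < 1"
    then show "L2_rate PI (P_DC MX MY pXY q KYX) < 1"
      unfolding DG DC by (intro rate_alternating_minorized[OF X Y H c minor]) auto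
  next
    fix r s :: real
    assume "r \<in> {0<..<1}" "s \<in> {0<..<1}" "L2_rate PI (P_RG MX MY KXY KYX r) < 1"
    then show "L2_rate PI (P_RC MX MY pXY q KYX s) < 1"
      unfolding RG RC by (intro rate_random_scan_minorized[OF X Y H c minor]) auto
  qed
qed

end
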